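(* Every Peano continuum $X$ is coverable. Moreover, there is a compact subset $S$ of the pathwise connected component of $\widetilde{X}$ containing the basepoint such that the restriction of the universal covering map $\phi:\widetilde{X}\to X$ to $S$ is surjective (onto $X$).
   Context: A Peano continuum is a Hausdorff topological space that is the continuous image of a (compact) interval; being compact, it is given the unique uniformity compatible with its topology. All entourages are taken to be symmetric. Fix a basepoint $*\in X$. For an entourage $E$ of $X$, an $E$-chain from $p$ to $q$ is a finite sequence $\{x_0=p,\dots,x_n=q\}$ with $(x_i,x_{i+1})\in E$ for all $i$. Two $E$-chains with the same endpoints are $E$-homotopic if one is obtained from the other in finitely many steps, each adding or removing a single point, always keeping the endpoints fixed and keeping an $E$-chain at each stage (in particular $\{p\}$ and $\{p,p\}$ are $E$-homotopic); $[\alpha]_E$ is the class of $\alpha$. $X_E$ is the set of $E$-homotopy classes of $E$-chains starting at $*$. For an entourage $D\subset E$ let $D^*$ be the set of pairs $([*=x_0,\dots,x_n,y]_E,[*=x_0,\dots,x_n,z]_E)$ with $(y,z)\in D$; $X_E$ carries the uniformity with base $\{D^*:D\subset E\}$. For $D\subset E$, $\phi_{ED}:X_D\to X_E$ is $[\alpha]_D\mapsto[\alpha]_E$. $\widetilde{X}=\varprojlim X_E$ (over all entourages, ordered by reverse inclusion, with the inverse limit uniformity and basepoint $*=([*]_E)_E$), with projections $\phi_E:\widetilde{X}\to X_E$ and $\phi:\widetilde{X}\to X=X_{X\times X}$; when $X$ is coverable, $\phi$ is called the universal covering map. $X$ is coverable if its uniformity has a base, containing $X\times X$, of entourages $E$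 for which $\phi_E$ is surjective. *)

theory Defs
  imports "HOL-Analysis.Analysis"
begin

section \<open>Uniformities on a carrier set\<close>

text \<open>
  The class \<open>uniform_space\<close> puts a uniformity on a whole type. The spaces of chain classes below
  are sets depending on an entourage, so uniformities are relativised to a carrier here.
\<close>

definition uniform_structure_on :: "'a set \<Rightarrow> ('a \<times> 'a) set set \<Rightarrow> bool" where
  "uniform_structure_on S \<U> \<longleftrightarrow>
     S \<times> S \<in> \<U> \<and>
     (\<forall>E\<in>\<U>. E \<subseteq> S \<times> S \<and> Id_on S \<subseteq> E \<and> E\<inverse> \<in> \<U> \<and> (\<exists>D\<in>\<U>. D O D \<subseteq> E)) \<and>
     (\<forall>D\<in>\<U>. \<forall>E. D \<subseteq> E \<and> E \<subseteq> S \<times> S \<longrightarrow> E \<in> \<U>) \<and>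
     (\<forall>D\<in>\<U>. \<forall>E\<in>\<U>. D \<inter> E \<in> \<U>)"

definition uniform_topology :: "'a set \<Rightarrow> ('a \<times> 'a) set set \<Rightarrow> 'a topology" where
  "uniform_topology S \<U> = topology (\<lambda>G. G \<subseteq> S \<and> (\<forall>x\<in>G. \<exists>E\<in>\<U>. E `` {x} \<subseteq> G))"

definition compatible_uniformity :: "'a topology \<Rightarrow> ('a \<times> 'a) set set \<Rightarrow> bool" where
  "compatible_uniformity X \<U> \<longleftrightarrow>
     uniform_structure_on (topspace X) \<U> \<and> uniform_topology (topspace X) \<U> = X"

definition uniformity_from_base :: "'a set \<Rightarrow> ('a \<times> 'a) set set \<Rightarrow> ('a \<times> 'a) set set" where
  "uniformity_from_base S \<B> = {E. E \<subseteq> S \<times> S \<and> (\<exists>D\<in>\<B>. D \<subseteq> E)}"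

definition entourages :: "('a \<times> 'a) set set \<Rightarrow> ('a \<times> 'a) set set" where
  "entourages \<U> = {E \<in> \<U>. sym E}"


section \<open>Chains and their homotopy classes\<close>

definition chain :: "('a \<times> 'a) set \<Rightarrow> 'a list \<Rightarrow> bool" where
  "chain E \<alpha> \<longleftrightarrow> \<alpha> \<noteq> [] \<and> successively (\<lambda>x y. (x, y) \<in> E) \<alpha>"

definition adds_point :: "'a list \<Rightarrow> 'a list \<Rightarrow> bool" where
  "adds_point \<alpha> \<beta> \<longleftrightarrow> (\<exists>xs z ys. \<alpha> = xs @ ys \<and> \<beta> = xs @ z # ys)"

definition chain_step :: "('a \<times> 'a) set \<Rightarrow> 'a list \<Rightarrow> 'a list \<Rightarrow> bool" where
  "chain_step E \<alpha> \<beta> \<longleftrightarrow> chain E \<alpha> \<and> chain E \<beta> \<and> hd \<alpha> = hd \<beta> \<and> last \<alpha> = last \<beta> \<and>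
     (adds_point \<alpha> \<beta> \<or> adds_point \<beta> \<alpha>)"

definition chain_homotopic :: "('a \<times> 'a) set \<Rightarrow> 'a list \<Rightarrow> 'a list \<Rightarrow> bool" where
  "chain_homotopic E = (chain_step E)\<^sup>*\<^sup>*"

definition chain_class :: "('a \<times> 'a) set \<Rightarrow> 'a list \<Rightarrow> 'a list set" where
  "chain_class E \<alpha> = {\<beta>. chain_homotopic E \<alpha> \<beta>}"

definition chain_space :: "'a \<Rightarrow> ('a \<times> 'a) set \<Rightarrow> 'a list set set" where
  "chain_space b E = {chain_class E \<alpha> | \<alpha>. chain E \<alpha> \<and> hd \<alpha> = b}"

definition lifted_entourage ::
    "'a \<Rightarrow> ('a \<times> 'a) set \<Rightarrow> ('a \<times> 'a) set \<Rightarrow> ('a list set \<times> 'a list set) set" where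
  "lifted_entourage b E D =
     {(chain_class E (\<alpha> @ [y]), chain_class E (\<alpha> @ [z])) | \<alpha> y z.
        \<alpha> \<noteq> [] \<and> hd \<alpha> = b \<and> chain E (\<alpha> @ [y]) \<and> chain E (\<alpha> @ [z]) \<and> (y, z) \<in> D}"

definition chain_uniformity ::
    "('a \<times> 'a) set set \<Rightarrow> 'a \<Rightarrow> ('a \<times> 'a) set \<Rightarrow> ('a list set \<times> 'a list set) set set" where
  "chain_uniformity \<U> b E =
     uniformity_from_base (chain_space b E) {lifted_entourage b E D | D. D \<in> entourages \<U> \<and> D \<subseteq> E}"

text \<open>
  The bonding map sends the class of a chain \<open>\<alpha>\<close> for a finer entourage to the class of \<open>\<alpha>\<close>
  for \<open>E\<close>; independence of the representative is \<open>bonding_map_chain_class\<close> below.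
\<close>

definition bonding_map :: "('a \<times> 'a) set \<Rightarrow> 'a list set \<Rightarrow> 'a list set" where
  "bonding_map E c = chain_class E (SOME \<alpha>. \<alpha> \<in> c)"

text \<open>
  For \<open>E = S \<times> S\<close> this identifies the space of chain classes with \<open>S\<close>
  (\<open>class_endpoint_chain_class\<close> and \<open>bij_betw_class_endpoint\<close> below).
\<close>

definition class_endpoint :: "'a list set \<Rightarrow> 'a" where
  "class_endpoint c = last (SOME \<alpha>. \<alpha> \<in> c)"


section \<open>The inverse limit\<close>

text \<open>Points of the limit are families indexed by the entourages, \<open>undefined\<close> elsewhere.\<close>

definition limit_space :: "('a \<times> 'a) set set \<Rightarrow> 'a \<Rightarrow> (('a \<times> 'a) set \<Rightarrow> 'a list set) set" where
  "limit_space \<U> b = {x \<in> (\<Pi>\<^sub>E E\<in>entourages \<U>. chain_space b E).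
     \<forall>D\<in>entourages \<U>. \<forall>E\<in>entourages \<U>. D \<subseteq> E \<longrightarrow> bonding_map E (x D) = x E}"

definition limit_basepoint :: "('a \<times> 'a) set set \<Rightarrow> 'a \<Rightarrow> ('a \<times> 'a) set \<Rightarrow> 'a list set" where
  "limit_basepoint \<U> b = (\<lambda>E\<in>entourages \<U>. chain_class E [b])"

definition limit_subbase :: "('a \<times> 'a) set set \<Rightarrow> 'a \<Rightarrow>
    ((('a \<times> 'a) set \<Rightarrow> 'a list set) \<times> (('a \<times> 'a) set \<Rightarrow> 'a list set)) set set" where
  "limit_subbase \<U> b = {{(x, y) \<in> limit_space \<U> b \<times> limit_space \<U> b. (x E, y E) \<in> W} | E W.
     E \<in> entourages \<U> \<and> W \<in> chain_uniformity \<U> b E}"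

definition limit_uniformity :: "('a \<times> 'a) set set \<Rightarrow> 'a \<Rightarrow>
    ((('a \<times> 'a) set \<Rightarrow> 'a list set) \<times> (('a \<times> 'a) set \<Rightarrow> 'a list set)) set set" where
  "limit_uniformity \<U> b = uniformity_from_base (limit_space \<U> b)
     {limit_space \<U> b \<times> limit_space \<U> b \<inter> \<Inter>\<F> | \<F>. finite \<F> \<and> \<F> \<subseteq> limit_subbase \<U> b}"

definition limit_topology ::
    "('a \<times> 'a) set set \<Rightarrow> 'a \<Rightarrow> (('a \<times> 'a) set \<Rightarrow> 'a list set) topology" where
  "limit_topology \<U> b = uniform_topology (limit_space \<U> b) (limit_uniformity \<U> b)"

definition universal_covering_map ::
    "'a set \<Rightarrow> (('a \<times> 'a) set \<Rightarrow> 'a list set) \<Rightarrow> 'a" where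
  "universal_covering_map S x = class_endpoint (x (S \<times> S))"

definition coverable :: "'a set \<Rightarrow> ('a \<times> 'a) set set \<Rightarrow> 'a \<Rightarrow> bool" where
  "coverable S \<U> b \<longleftrightarrow>
     (\<exists>\<B> \<subseteq> entourages \<U>. S \<times> S \<in> \<B> \<and> (\<forall>E\<in>\<U>. \<exists>D\<in>\<B>. D \<subseteq> E) \<and>
        (\<forall>E\<in>\<B>. (\<lambda>x. x E) ` limit_space \<U> b = chain_space b E))"


section \<open>Peano continua\<close>

definition Peano_continuum :: "'a topology \<Rightarrow> bool" where
  "Peano_continuum X \<longleftrightarrow>
     Hausdorff_space X \<and> (\<exists>g. pathin X g \<and> g ` {0..1} = topspace X)"


section \<open>Well-definedness\<close>

lemma
  assumes "uniform_structure_on S \<U>"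
  shows uniform_structure_full: "S \<times> S \<in> \<U>"
    and uniform_structure_subset: "E \<in> \<U> \<Longrightarrow> E \<subseteq> S \<times> S"
    and uniform_structure_diag: "E \<in> \<U> \<Longrightarrow> Id_on S \<subseteq> E"
    and uniform_structure_converse: "E \<in> \<U> \<Longrightarrow> E\<inverse> \<in> \<U>"
    and uniform_structure_half: "E \<in> \<U> \<Longrightarrow> \<exists>D\<in>\<U>. D O D \<subseteq> E"
    and uniform_structure_Int: "D \<in> \<U> \<Longrightarrow> E \<in> \<U> \<Longrightarrow> D \<inter> E \<in> \<U>"
proof -
  note * = assms[unfolded uniform_structure_on_def]
  show "S \<times> S \<in> \<U>" by (rule *[THEN conjunct1])
  note ** = *[THEN conjunct2, THEN conjunct1, THEN bspec]
  show "E \<in> \<U> \<Longrightarrow> E \<subseteq> S \<times> S" by (drule **) (elim conjE)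
  show "E \<in> \<U> \<Longrightarrow> Id_on S \<subseteq> E" by (drule **) (elim conjE)
  show "E \<in> \<U> \<Longrightarrow> E\<inverse> \<in> \<U>" by (drule **) (elim conjE)
  show "E \<in> \<U> \<Longrightarrow> \<exists>D\<in>\<U>. D O D \<subseteq> E" by (drule **) (elim conjE)
  show "D \<in> \<U> \<Longrightarrow> E \<in> \<U> \<Longrightarrow> D \<inter> E \<in> \<U>"
    using *[THEN conjunct2, THEN conjunct2, THEN conjunct2] by simp
qed

lemma openin_uniform_topology:
  assumes "uniform_structure_on S \<U>"
  shows "openin (uniform_topology S \<U>) G \<longleftrightarrow> G \<subseteq> S \<and> (\<forall>x\<in>G. \<exists>E\<in>\<U>. E `` {x} \<subseteq> G)"
proof -
  define P where "P = (\<lambda>G. G \<subseteq> S \<and> (\<forall>x\<in>G. \<exists>E\<in>\<U>. E `` {x} \<subseteq> G))"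
  have "P (G \<inter> H)" if G: "P G" and H: "P H" for G H
    unfolding P_def
  proof (intro conjI ballI)
    show "G \<inter> H \<subseteq> S" using G by (auto simp: P_def)
    fix x assume x: "x \<in> G \<inter> H"
    have "\<exists>D\<in>\<U>. D `` {x} \<subseteq> G" "\<exists>E\<in>\<U>. E `` {x} \<subseteq> H"
      using G H x by (simp_all add: P_def)
    then obtain D E where "D \<in> \<U>" "E \<in> \<U>" "D `` {x} \<subseteq> G" "E `` {x} \<subseteq> H"
      by (elim bexE)
    moreover from this have "D \<inter> E \<in> \<U>"
      using uniform_structure_Int[OF assms] by simp
    ultimately show "\<exists>E\<in>\<U>. E `` {x} \<subseteq> G \<inter> H"
      by (intro bexI[of _ "D \<inter> E"]) auto
  qed
  moreover have "P (\<Union>\<K>)" if "\<forall>K\<in>\<K>. P K" for \<K>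
    unfolding P_def
  proof (intro conjI ballI)
    show "\<Union>\<K> \<subseteq> S" using that by (auto simp: P_def)
    fix x assume "x \<in> \<Union>\<K>"
    then obtain K where K: "K \<in> \<K>" "x \<in> K" by (elim UnionE)
    then have "\<exists>E\<in>\<U>. E `` {x} \<subseteq> K" using that by (simp add: P_def)
    with K(1) show "\<exists>E\<in>\<U>. E `` {x} \<subseteq> \<Union>\<K>" by blast
  qed
  ultimately have "istopology P" by (simp add: istopology_def)
  then have "openin (topology P) G \<longleftrightarrow> P G" by (simp add: topology_inverse')
  then show ?thesis unfolding uniform_topology_def P_def .
qed

lemma topspace_uniform_topology:
  assumes "uniform_structure_on S \<U>"
  shows "topspace (uniform_topology S \<U>) = S"
proof -
  have "openin (uniform_topology S \<U>) S"
    unfolding openin_uniform_topology[OF assms]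
    using uniform_structure_full[OF assms] by auto
  then show ?thesis
    using openin_uniform_topology[OF assms, of "topspace (uniform_topology S \<U>)"]
      openin_subset[of "uniform_topology S \<U>" S] by auto
qed

lemma chain_mono: "chain D \<alpha> \<Longrightarrow> D \<subseteq> E \<Longrightarrow> chain E \<alpha>"
  unfolding chain_def by (auto intro: successively_mono)

lemma chain_homotopic_mono:
  assumes "chain_homotopic D \<alpha> \<beta>" "D \<subseteq> E"
  shows "chain_homotopic E \<alpha> \<beta>"
proof -
  have "chain_step D \<le> chain_step E"
    using chain_mono[OF _ assms(2)] by (auto simp: chain_step_def)
  from rtranclp_mono[OF this] show ?thesis
    using assms(1) by (auto simp: chain_homotopic_def)
qed

lemma chain_homotopic_sym: "chain_homotopic E \<alpha> \<beta> \<Longrightarrow> chain_homotopic E \<beta> \<alpha>"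
proof -
  have "symp (chain_step E)" by (auto simp: symp_def chain_step_def)
  from symp_rtranclp[OF this] show "chain_homotopic E \<alpha> \<beta> \<Longrightarrow> chain_homotopic E \<beta> \<alpha>"
    by (simp add: chain_homotopic_def symp_def)
qed

lemma chain_homotopic_endpoints:
  assumes "chain_homotopic E \<alpha> \<beta>"
  shows "hd \<alpha> = hd \<beta>" "last \<alpha> = last \<beta>"
  using assms unfolding chain_homotopic_def
  by (induction rule: rtranclp_induct) (auto simp: chain_step_def)

lemma chain_homotopic_chain: "chain_homotopic E \<alpha> \<beta> \<Longrightarrow> chain E \<alpha> \<Longrightarrow> chain E \<beta>"
  unfolding chain_homotopic_def
  by (induction rule: rtranclp_induct) (auto simp: chain_step_def)

lemma self_in_chain_class: "\<alpha> \<in> chain_class E \<alpha>"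
  by (simp add: chain_class_def chain_homotopic_def)

lemma chain_class_eq_iff: "chain_class E \<alpha> = chain_class E \<beta> \<longleftrightarrow> chain_homotopic E \<alpha> \<beta>"
proof
  assume "chain_class E \<alpha> = chain_class E \<beta>"
  then show "chain_homotopic E \<alpha> \<beta>"
    using self_in_chain_class[of \<beta> E] by (metis chain_class_def mem_Collect_eq)
next
  assume *: "chain_homotopic E \<alpha> \<beta>"
  note ** = chain_homotopic_sym[OF this]
  show "chain_class E \<alpha> = chain_class E \<beta>"
    using * ** unfolding chain_class_def chain_homotopic_def by (auto intro: rtranclp_trans)
qed

lemma some_in_chain_class: "chain_homotopic E \<alpha> (SOME \<beta>. \<beta> \<in> chain_class E \<alpha>)"
  using someI[of "\<lambda>\<beta>. \<beta> \<in> chain_class E \<alpha>", OF self_in_chain_class]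
  by (simp add: chain_class_def)

lemma bonding_map_chain_class:
  assumes "D \<subseteq> E"
  shows "bonding_map E (chain_class D \<alpha>) = chain_class E \<alpha>"
  unfolding bonding_map_def chain_class_eq_iff
  by (rule chain_homotopic_sym, rule chain_homotopic_mono[OF some_in_chain_class assms])

lemma class_endpoint_chain_class: "class_endpoint (chain_class E \<alpha>) = last \<alpha>"
  unfolding class_endpoint_def
  using chain_homotopic_endpoints(2)[OF some_in_chain_class] by metis

lemma chain_full:
  assumes "\<alpha> \<noteq> []" "set \<alpha> \<subseteq> S"
  shows "chain (S \<times> S) \<alpha>"
  unfolding chain_def using assms
  by (induction \<alpha> rule: induct_list012) auto

lemma chain_set:
  assumes "chain E \<alpha>" "E \<subseteq> S \<times> S" "hd \<alpha> \<in> S"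
  shows "set \<alpha> \<subseteq> S"
  using assms unfolding chain_def
  by (induction \<alpha> rule: induct_list012) auto

lemma chain_homotopic_full:
  assumes "\<alpha> \<noteq> []" "set \<alpha> \<subseteq> S"
  shows "chain_homotopic (S \<times> S) \<alpha> [hd \<alpha>, last \<alpha>]"
  using assms
proof (induction "length \<alpha>" arbitrary: \<alpha> rule: less_induct)
  case less
  consider x where "\<alpha> = [x]" | x y where "\<alpha> = [x, y]" | x y w ws where "\<alpha> = x # y # w # ws"
    using less.prems(1) by (metis neq_Nil_conv)
  then show ?case
  proof cases
    case 1
    then have "chain_step (S \<times> S) [x] [x, x]"
      unfolding chain_step_def adds_point_def using less.prems
      by (auto simp: chain_def intro!: exI[of _ "[]"])
    then show ?thesis using 1 by (simp add: chain_homotopic_def)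
  next
    case 2
    then show ?thesis by (simp add: chain_homotopic_def)
  next
    case 3
    have "adds_point (x # w # ws) (x # y # w # ws)"
      unfolding adds_point_def by (intro exI[of _ "[x]"] exI[of _ y] exI[of _ "w # ws"]) auto
    then have "chain_step (S \<times> S) \<alpha> (x # w # ws)"
      unfolding chain_step_def using less.prems 3 by (auto intro!: chain_full)
    moreover have "chain_homotopic (S \<times> S) (x # w # ws) [hd \<alpha>, last \<alpha>]"
      using less.hyps[of "x # w # ws"] less.prems 3 by simp
    ultimately show ?thesis
      by (simp add: chain_homotopic_def converse_rtranclp_into_rtranclp)
  qed
qed

lemma bij_betw_class_endpoint:
  assumes "b \<in> S"
  shows "bij_betw class_endpoint (chain_space b (S \<times> S)) S"
proof (rule bij_betw_imageI)
  have set: "set \<alpha> \<subseteq> S" if "chain (S \<times> S) \<alpha>" "hd \<alpha> = b" for \<alpha>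
    using chain_set[OF that(1)] that(2) assms by simp
  show "inj_on class_endpoint (chain_space b (S \<times> S))"
  proof (rule inj_onI)
    fix c d
    assume "c \<in> chain_space b (S \<times> S)" "d \<in> chain_space b (S \<times> S)"
      and eq: "class_endpoint c = class_endpoint d"
    then obtain \<alpha> \<beta> where \<alpha>: "c = chain_class (S \<times> S) \<alpha>" "chain (S \<times> S) \<alpha>" "hd \<alpha> = b"
      and \<beta>: "d = chain_class (S \<times> S) \<beta>" "chain (S \<times> S) \<beta>" "hd \<beta> = b"
      unfolding chain_space_def by auto
    have "last \<alpha> = last \<beta>"
      using eq \<alpha>(1) \<beta>(1) by (simp add: class_endpoint_chain_class)
    then have "chain_class (S \<times> S) \<alpha> = chain_class (S \<times> S) \<beta>"
      using chain_homotopic_full[of \<alpha> S] chain_homotopic_full[of \<beta> S] \<alpha> \<beta> set[of \<alpha>] set[of \<beta>]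
      by (metis chain_class_eq_iff chain_def)
    then show "c = d" using \<alpha>(1) \<beta>(1) by simp
  qed
  show "class_endpoint ` chain_space b (S \<times> S) = S"
  proof (intro equalityI subsetI)
    fix y assume "y \<in> class_endpoint ` chain_space b (S \<times> S)"
    then obtain \<alpha> where "y = last \<alpha>" "chain (S \<times> S) \<alpha>" "hd \<alpha> = b"
      unfolding chain_space_def by (auto simp: class_endpoint_chain_class)
    with set[of \<alpha>] show "y \<in> S"
      unfolding chain_def by (metis last_in_set subsetD)
  next
    fix y assume "y \<in> S"
    then have "chain_class (S \<times> S) [b, y] \<in> chain_space b (S \<times> S)"
      using assms by (auto simp: chain_space_def chain_def intro!: exI[of _ "[b, y]"])
    moreover have "class_endpoint (chain_class (S \<times> S) [b, y]) = y"
      by (simp add: class_endpoint_chain_class)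
    ultimately show "y \<in> class_endpoint ` chain_space b (S \<times> S)"
      by (metis imageI)
  qed
qed

lemma uniform_structure_on_from_base:
  assumes "\<B> \<noteq> {}"
    and sub: "\<And>D. D \<in> \<B> \<Longrightarrow> D \<subseteq> S \<times> S"
    and diag: "\<And>D. D \<in> \<B> \<Longrightarrow> Id_on S \<subseteq> D"
    and sym: "\<And>D. D \<in> \<B> \<Longrightarrow> \<exists>E\<in>\<B>. E \<subseteq> D\<inverse>"
    and comp: "\<And>D. D \<in> \<B> \<Longrightarrow> \<exists>E\<in>\<B>. E O E \<subseteq> D"
    and int: "\<And>D E. D \<in> \<B> \<Longrightarrow> E \<in> \<B> \<Longrightarrow> \<exists>F\<in>\<B>. F \<subseteq> D \<inter> E"
  shows "uniform_structure_on S (uniformity_from_base S \<B>)"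
  unfolding uniform_structure_on_def
proof (intro conjI ballI allI impI)
  show "S \<times> S \<in> uniformity_from_base S \<B>"
    using assms(1) sub by (auto simp: uniformity_from_base_def)
next
  fix E assume "E \<in> uniformity_from_base S \<B>"
  then obtain D where D: "D \<in> \<B>" "D \<subseteq> E" and E: "E \<subseteq> S \<times> S"
    by (auto simp: uniformity_from_base_def)
  show "E \<subseteq> S \<times> S" by fact
  show "Id_on S \<subseteq> E" using diag[OF D(1)] D(2) by blast
  show "E\<inverse> \<in> uniformity_from_base S \<B>"
    using sym[OF D(1)] D(2) E unfolding uniformity_from_base_def by blast
  obtain D' where "D' \<in> \<B>" "D' O D' \<subseteq> D" using comp[OF D(1)] by blast
  then show "\<exists>D\<in>uniformity_from_base S \<B>. D O D \<subseteq> E"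
    using sub D(2) by (intro bexI[of _ D']) (auto simp: uniformity_from_base_def)
next
  fix D E assume "D \<in> uniformity_from_base S \<B>" "D \<subseteq> E \<and> E \<subseteq> S \<times> S"
  then show "E \<in> uniformity_from_base S \<B>"
    unfolding uniformity_from_base_def by blast
next
  fix D E assume "D \<in> uniformity_from_base S \<B>" "E \<in> uniformity_from_base S \<B>"
  then obtain D' E' where "D' \<in> \<B>" "D' \<subseteq> D" "E' \<in> \<B>" "E' \<subseteq> E" "D \<subseteq> S \<times> S"
    by (auto simp: uniformity_from_base_def)
  then show "D \<inter> E \<in> uniformity_from_base S \<B>"
    using int[of D' E'] unfolding uniformity_from_base_def by blast
qed

lemma chain_snoc:
  assumes "\<alpha> \<noteq> []"
  shows "chain E (\<alpha> @ [y]) \<longleftrightarrow> chain E \<alpha> \<and> (last \<alpha>, y) \<in> E"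
  using assms by (auto simp: chain_def successively_append_iff)

lemma chain_homotopic_snoc:
  assumes "chain_homotopic E \<alpha> \<beta>" "chain E \<alpha>" "(last \<alpha>, y) \<in> E"
  shows "chain_homotopic E (\<alpha> @ [y]) (\<beta> @ [y])"
  using assms(1) unfolding chain_homotopic_def
proof (induction rule: rtranclp_induct)
  case (step \<beta> \<gamma>)
  have adds: "adds_point (\<sigma> @ [y]) (\<tau> @ [y])" if "adds_point \<sigma> \<tau>" for \<sigma> \<tau>
    using that unfolding adds_point_def by (metis append.assoc append_Cons)
  have last: "last \<beta> = last \<alpha>" "last \<gamma> = last \<alpha>"
    using step(1,2) chain_homotopic_endpoints(2)[of E \<alpha> \<beta>]
    by (auto simp: chain_homotopic_def chain_step_def)
  have "chain_step E (\<beta> @ [y]) (\<gamma> @ [y])"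
    using step(2) adds assms(3) last
    by (auto simp: chain_step_def chain_snoc chain_def successively_append_iff)
  with step(3) show ?case by simp
qed simp

lemma chain_homotopic_detour:
  assumes "\<alpha> \<noteq> []" "chain E (\<alpha> @ [y])" "chain E (\<alpha> @ [z])" "(z, y) \<in> E"
  shows "chain_homotopic E (\<alpha> @ [y]) (\<alpha> @ [z, y])"
proof -
  have "chain E (\<alpha> @ [z, y])"
    using assms chain_snoc[of "\<alpha> @ [z]" E y] by simp
  moreover have "adds_point (\<alpha> @ [y]) (\<alpha> @ [z, y])"
    unfolding adds_point_def by blast
  ultimately have "chain_step E (\<alpha> @ [y]) (\<alpha> @ [z, y])"
    using assms by (auto simp: chain_step_def)
  then show ?thesis by (simp add: chain_homotopic_def)
qed

lemma entourage_Int: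
  assumes "uniform_structure_on S \<U>" "D \<in> entourages \<U>" "E \<in> entourages \<U>"
  shows "D \<inter> E \<in> entourages \<U>"
  using uniform_structure_Int[OF assms(1)] assms(2,3) by (simp add: entourages_def sym_Int)

lemma entourage_half:
  assumes "uniform_structure_on S \<U>" "E \<in> entourages \<U>"
  obtains D where "D \<in> entourages \<U>" "D \<subseteq> E" "D O D \<subseteq> E"
proof -
  obtain D where D: "D \<in> \<U>" "D O D \<subseteq> E"
    using uniform_structure_half[OF assms(1)] assms(2) by (auto simp: entourages_def)
  then have "D \<inter> D\<inverse> \<in> entourages \<U>"
    using uniform_structure_Int[OF assms(1)] uniform_structure_converse[OF assms(1)]
    by (auto simp: entourages_def sym_def)
  from entourage_Int[OF assms(1) this assms(2)] show thesis
    using D(2) by (intro that[of "D \<inter> D\<inverse> \<inter> E"]) auto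
qed

lemma lifted_entourageI:
  assumes "\<alpha> \<noteq> []" "hd \<alpha> = b" "chain E (\<alpha> @ [y])" "chain E (\<alpha> @ [z])" "(y, z) \<in> D"
  shows "(chain_class E (\<alpha> @ [y]), chain_class E (\<alpha> @ [z])) \<in> lifted_entourage b E D"
  using assms unfolding lifted_entourage_def by blast

lemma uniform_structure_on_chain_space:
  assumes U: "uniform_structure_on S \<U>" and b: "b \<in> S" and E: "E \<in> entourages \<U>"
  shows "uniform_structure_on (chain_space b E) (chain_uniformity \<U> b E)"
  unfolding chain_uniformity_def
proof (rule uniform_structure_on_from_base; (elim CollectE exE conjE)?; (hypsubst)?)
  have ES: "E \<subseteq> S \<times> S"
    using uniform_structure_subset[OF U] E by (auto simp: entourages_def)
  have refl: "(x, x) \<in> D" if "D \<in> entourages \<U>" "x \<in> S" for D x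
    using uniform_structure_diag[OF U, of D] that by (auto simp: entourages_def)
  have symD: "sym D" if "D \<in> entourages \<U>" for D
    using that by (simp add: entourages_def)
  show "{lifted_entourage b E D | D. D \<in> entourages \<U> \<and> D \<subseteq> E} \<noteq> {}"
    using E by auto
  fix D assume D: "D \<in> entourages \<U>" "D \<subseteq> E"
  show "lifted_entourage b E D \<subseteq> chain_space b E \<times> chain_space b E"
    unfolding lifted_entourage_def chain_space_def by fastforce
  show "Id_on (chain_space b E) \<subseteq> lifted_entourage b E D"
  proof
    fix p assume "p \<in> Id_on (chain_space b E)"
    then obtain \<alpha> where p: "p = (chain_class E \<alpha>, chain_class E \<alpha>)" and \<alpha>: "chain E \<alpha>" "hd \<alpha> = b"
      by (auto simp: chain_space_def)
    have ne: "\<alpha> \<noteq> []" using \<alpha> by (simp add: chain_def)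
    have "last \<alpha> \<in> S" using chain_set[OF \<alpha>(1) ES] \<alpha>(2) b ne last_in_set by blast
    with refl D E have l: "(last \<alpha>, last \<alpha>) \<in> D" "(last \<alpha>, last \<alpha>) \<in> E" by auto
    have "adds_point \<alpha> (\<alpha> @ [last \<alpha>])" unfolding adds_point_def by force
    then have "chain_step E \<alpha> (\<alpha> @ [last \<alpha>])"
      using \<alpha> ne l by (simp add: chain_step_def chain_snoc)
    then have "chain_class E \<alpha> = chain_class E (\<alpha> @ [last \<alpha>])"
      by (simp add: chain_class_eq_iff chain_homotopic_def)
    then show "p \<in> lifted_entourage b E D"
      unfolding p using \<alpha> ne l by (simp add: lifted_entourageI chain_snoc)
  qed
  have "lifted_entourage b E D \<subseteq> (lifted_entourage b E D)\<inverse>"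
    using symD[OF D(1)] unfolding lifted_entourage_def by (fastforce dest: Relation.symD)
  then show "\<exists>F\<in>{lifted_entourage b E D | D. D \<in> entourages \<U> \<and> D \<subseteq> E}. F \<subseteq> (lifted_entourage b E D)\<inverse>"
    using D by blast
  obtain C where C: "C \<in> entourages \<U>" "C \<subseteq> D" "C O C \<subseteq> D"
    using entourage_half[OF U D(1)] .
  have "lifted_entourage b E C O lifted_entourage b E C \<subseteq> lifted_entourage b E D"
  proof
    fix p assume "p \<in> lifted_entourage b E C O lifted_entourage b E C"
    then obtain \<alpha> y z \<beta> z' w where
        p: "p = (chain_class E (\<alpha> @ [y]), chain_class E (\<beta> @ [w]))"
      and \<alpha>: "\<alpha> \<noteq> []" "hd \<alpha> = b" "chain E (\<alpha> @ [y])" "chain E (\<alpha> @ [z])" "(y, z) \<in> C"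
      and \<beta>: "\<beta> \<noteq> []" "hd \<beta> = b" "chain E (\<beta> @ [z'])" "chain E (\<beta> @ [w])" "(z', w) \<in> C"
      and eq: "chain_class E (\<alpha> @ [z]) = chain_class E (\<beta> @ [z'])"
      unfolding lifted_entourage_def relcomp_unfold by blast
    have hom: "chain_homotopic E (\<alpha> @ [z]) (\<beta> @ [z'])"
      using eq by (simp add: chain_class_eq_iff)
    then have z: "z' = z" using chain_homotopic_endpoints(2) by fastforce
    have zy: "(z, y) \<in> E" "(z, w) \<in> E" "(y, w) \<in> D"
      using \<alpha>(5) \<beta>(5) C D z symD[OF C(1)] by (auto dest: Relation.symD)
    have "chain_class E (\<alpha> @ [y]) = chain_class E (\<alpha> @ [z, y])"
      using chain_homotopic_detour[OF \<alpha>(1,3,4) zy(1)] by (simp add: chain_class_eq_iff)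
    also have "\<dots> = chain_class E (\<beta> @ [z, y])"
      using chain_homotopic_snoc[OF hom \<alpha>(4), of y] zy(1) z by (simp add: chain_class_eq_iff)
    finally have y: "chain_class E (\<alpha> @ [y]) = chain_class E ((\<beta> @ [z]) @ [y])" by simp
    have w: "chain_class E (\<beta> @ [w]) = chain_class E ((\<beta> @ [z]) @ [w])"
      using chain_homotopic_detour[of \<beta> E w z] \<beta> z zy by (simp add: chain_class_eq_iff)
    have "chain E ((\<beta> @ [z]) @ [y])" "chain E ((\<beta> @ [z]) @ [w])" "hd (\<beta> @ [z]) = b"
      using \<beta> z zy chain_snoc[of "\<beta> @ [z]" E] by auto
    then show "p \<in> lifted_entourage b E D"
      unfolding p y w using zy(3) by (intro lifted_entourageI) auto
  qed
  then show "\<exists>F\<in>{lifted_entourage b E D | D. D \<in> entourages \<U> \<and> D \<subseteq> E}. F O F \<subseteq> lifted_entourage b E D"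
    using C D by blast
  fix D' assume "D' \<in> entourages \<U>" "D' \<subseteq> E"
  then have "D \<inter> D' \<in> entourages \<U>" "D \<inter> D' \<subseteq> E"
    using entourage_Int[OF U D(1)] D(2) by auto
  moreover have "lifted_entourage b E (D \<inter> D') \<subseteq> lifted_entourage b E D \<inter> lifted_entourage b E D'"
    unfolding lifted_entourage_def by blast
  ultimately show "\<exists>F\<in>{lifted_entourage b E D | D. D \<in> entourages \<U> \<and> D \<subseteq> E}.
      F \<subseteq> lifted_entourage b E D \<inter> lifted_entourage b E D'" by blast
qed

lemma uniform_structure_on_limit_space:
  assumes U: "uniform_structure_on S \<U>" and b: "b \<in> S"
  shows "uniform_structure_on (limit_space \<U> b) (limit_uniformity \<U> b)"
proof -
  let ?L = "limit_space \<U> b" and ?B = "limit_subbase \<U> b"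
  let ?pre = "\<lambda>E W. {(x, y) \<in> ?L \<times> ?L. (x E, y E) \<in> W}"
  have mem: "x E \<in> chain_space b E" if "x \<in> ?L" "E \<in> entourages \<U>" for x E
    using that by (auto simp: limit_space_def)
  have uni: "uniform_structure_on (chain_space b E) (chain_uniformity \<U> b E)" if "E \<in> entourages \<U>" for E
    using uniform_structure_on_chain_space[OF U b that] .
  have diag: "Id_on ?L \<subseteq> V" if V: "V \<in> ?B" for V
  proof -
    obtain E W where EW: "V = ?pre E W" "E \<in> entourages \<U>" "W \<in> chain_uniformity \<U> b E"
      using V unfolding limit_subbase_def by blast
    then have "Id_on (chain_space b E) \<subseteq> W"
      by (intro uniform_structure_diag[OF uni])
    then show ?thesis using EW mem by (auto simp: Id_on_def)
  qed
  have sym: "V\<inverse> \<in> ?B" if V: "V \<in> ?B" for V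
  proof -
    obtain E W where EW: "V = ?pre E W" "E \<in> entourages \<U>" "W \<in> chain_uniformity \<U> b E"
      using V unfolding limit_subbase_def by blast
    have "V\<inverse> = ?pre E (W\<inverse>)" using EW by auto
    moreover have "W\<inverse> \<in> chain_uniformity \<U> b E"
      by (rule uniform_structure_converse[OF uni[OF EW(2)] EW(3)])
    ultimately show ?thesis
      using EW(2) unfolding limit_subbase_def by blast
  qed
  have "\<exists>V'\<in>?B. V' O V' \<subseteq> V" if V: "V \<in> ?B" for V
  proof -
    obtain E W where EW: "V = ?pre E W" "E \<in> entourages \<U>" "W \<in> chain_uniformity \<U> b E"
      using V unfolding limit_subbase_def by blast
    obtain W' where W': "W' \<in> chain_uniformity \<U> b E" "W' O W' \<subseteq> W"
      using uniform_structure_half[OF uni[OF EW(2)] EW(3)] by blast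
    have "?pre E W' \<in> ?B" using EW(2) W'(1) unfolding limit_subbase_def by blast
    moreover have "?pre E W' O ?pre E W' \<subseteq> V" unfolding EW(1) using W'(2) by auto
    ultimately show ?thesis by blast
  qed
  then obtain h where h: "\<And>V. V \<in> ?B \<Longrightarrow> h V \<in> ?B" "\<And>V. V \<in> ?B \<Longrightarrow> h V O h V \<subseteq> V"
    by metis
  let ?base = "{?L \<times> ?L \<inter> \<Inter>\<F> | \<F>. finite \<F> \<and> \<F> \<subseteq> ?B}"
  have baseI: "?L \<times> ?L \<inter> \<Inter>\<F> \<in> ?base" if "finite \<F>" "\<F> \<subseteq> ?B" for \<F>
    using that by blast
  show ?thesis
    unfolding limit_uniformity_def
  proof (rule uniform_structure_on_from_base)
    show "?base \<noteq> {}" using baseI[of "{}"] by blast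
    fix D assume "D \<in> ?base"
    then obtain \<F> where D: "D = ?L \<times> ?L \<inter> \<Inter>\<F>" "finite \<F>" "\<F> \<subseteq> ?B" by blast
    show "D \<subseteq> ?L \<times> ?L" using D by blast
    show "Id_on ?L \<subseteq> D" using D diag by (auto simp: Id_on_def)
    have "?L \<times> ?L \<inter> \<Inter>(converse ` \<F>) \<in> ?base"
      using D sym by (intro baseI) auto
    moreover have "?L \<times> ?L \<inter> \<Inter>(converse ` \<F>) \<subseteq> D\<inverse>" unfolding D(1) by auto
    ultimately show "\<exists>E\<in>?base. E \<subseteq> D\<inverse>" by (rule bexI[rotated])
    have "?L \<times> ?L \<inter> \<Inter>(h ` \<F>) \<in> ?base"
      using D h(1) by (intro baseI) auto
    moreover have "(?L \<times> ?L \<inter> \<Inter>(h ` \<F>)) O (?L \<times> ?L \<inter> \<Inter>(h ` \<F>)) \<subseteq> D"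
      unfolding D(1) using h(2) D(3) by (auto simp: subset_iff relcomp_unfold) blast
    ultimately show "\<exists>E\<in>?base. E O E \<subseteq> D" by (rule bexI[rotated])
    fix E assume "E \<in> ?base"
    then obtain \<G> where E: "E = ?L \<times> ?L \<inter> \<Inter>\<G>" "finite \<G>" "\<G> \<subseteq> ?B" by blast
    have "?L \<times> ?L \<inter> \<Inter>(\<F> \<union> \<G>) \<in> ?base"
      using D E by (intro baseI) auto
    moreover have "?L \<times> ?L \<inter> \<Inter>(\<F> \<union> \<G>) \<subseteq> D \<inter> E" unfolding D(1) E(1) by auto
    ultimately show "\<exists>F\<in>?base. F \<subseteq> D \<inter> E" by (rule bexI[rotated])
  qed
qed

lemma limit_basepoint_in_limit_space:
  "limit_basepoint \<U> b \<in> limit_space \<U> b"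
  unfolding limit_basepoint_def limit_space_def
  by (auto simp: bonding_map_chain_class chain_space_def chain_def intro!: exI[of _ "[b]"])

lemma compact_Hausdorff_uniformizable:
  assumes "compact_space X" "Hausdorff_space X"
  shows "\<exists>\<U>. compatible_uniformity X \<U>"
proof -
  let ?S = "topspace X"
  define \<U> where "\<U> = {E. E \<subseteq> ?S \<times> ?S \<and> (\<exists>W. openin (prod_topology X X) W \<and> Id_on ?S \<subseteq> W \<and> W \<subseteq> E)}"
  have conv: "openin (prod_topology X X) (W\<inverse>)" if "openin (prod_topology X X) W" for W
  proof -
    have "openin (prod_topology X X) {p \<in> topspace (prod_topology X X). (snd p, fst p) \<in> W}"
      by (intro openin_continuous_map_preimage[OF _ that] continuous_map_pairedI
          continuous_map_fst continuous_map_snd)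
    moreover have "{p \<in> topspace (prod_topology X X). (snd p, fst p) \<in> W} = W\<inverse>"
      using openin_subset[OF that] by auto
    ultimately show ?thesis by simp
  qed
  have half: "\<exists>D\<in>\<U>. D O D \<subseteq> W" if W: "openin (prod_topology X X) W" "Id_on ?S \<subseteq> W" for W
  proof -
    have "\<exists>G H C. openin X G \<and> openin X H \<and> closedin X C \<and> x \<in> H \<and> H \<subseteq> C \<and> C \<subseteq> G \<and> G \<times> G \<subseteq> W"
      if x: "x \<in> ?S" for x
    proof -
      have "(x, x) \<in> W" using W(2) x by auto
      then obtain A B where AB: "openin X A" "openin X B" "x \<in> A" "x \<in> B" "A \<times> B \<subseteq> W"
        using W(1)[unfolded openin_prod_topology_alt, rule_format, OF \<open>(x, x) \<in> W\<close>]
        by (elim exE conjE)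
      have "neighbourhood_base_of (closedin X) X"
        using assms compact_Hausdorff_imp_regular_space neighbourhood_base_of_closedin by blast
      moreover have "openin X (A \<inter> B)" "x \<in> A \<inter> B" using AB by auto
      ultimately obtain H C where "openin X H" "closedin X C" "x \<in> H" "H \<subseteq> C" "C \<subseteq> A \<inter> B"
        unfolding neighbourhood_base_of by meson
      with AB \<open>openin X (A \<inter> B)\<close> show ?thesis
        by (intro exI[of _ "A \<inter> B"] exI[of _ H] exI[of _ C]) auto
    qed
    then obtain G H C where GHC: "\<And>x. x \<in> ?S \<Longrightarrow> openin X (G x) \<and> openin X (H x) \<and> closedin X (C x) \<and>
        x \<in> H x \<and> H x \<subseteq> C x \<and> C x \<subseteq> G x \<and> G x \<times> G x \<subseteq> W"
      by metis
    have "\<exists>\<F>. finite \<F> \<and> \<F> \<subseteq> H ` ?S \<and> ?S \<subseteq> \<Union>\<F>"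
    proof (rule assms(1)[unfolded compact_space_alt, rule_format, of "H ` ?S"], intro conjI ballI)
      show "openin X K" if "K \<in> H ` ?S" for K using that GHC by (elim imageE) simp
      show "?S \<subseteq> \<Union>(H ` ?S)"
      proof
        fix x assume "x \<in> ?S"
        then show "x \<in> \<Union>(H ` ?S)" using GHC[of x] by (intro UN_I) auto
      qed
    qed
    then obtain \<F> where \<F>: "finite \<F>" "\<F> \<subseteq> H ` ?S" "?S \<subseteq> \<Union>\<F>" by (elim exE conjE)
    obtain I where "finite I" "I \<subseteq> ?S" "\<F> = H ` I"
      using finite_subset_image[OF \<F>(1,2)] by blast
    with \<F>(3) have I: "finite I" "I \<subseteq> ?S" "?S \<subseteq> \<Union>(H ` I)" by auto
    define D where "D = ?S \<times> ?S \<inter> (\<Inter>x\<in>I. ?S \<times> G x \<union> (?S - C x) \<times> ?S)"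
    have open_i: "openin (prod_topology X X) (?S \<times> G x \<union> (?S - C x) \<times> ?S)" if "x \<in> I" for x
    proof -
      have "openin X (G x)" "closedin X (C x)" using GHC[of x] I(2) that by auto
      then have "openin X (G x)" "openin X (?S - C x)" by (auto intro: openin_diff)
      then show ?thesis by (intro openin_Un) (simp_all add: openin_prod_Times_iff)
    qed
    have "openin (prod_topology X X) (?S \<times> ?S)" by (simp add: openin_prod_Times_iff)
    then have D_open: "openin (prod_topology X X) D"
      using I(1) open_i unfolding D_def by (cases "I = {}") (simp_all add: openin_Int openin_INT2)
    have D_sub: "D \<subseteq> ?S \<times> ?S" unfolding D_def by (rule Int_lower1)
    have D_iff: "(y, z) \<in> D \<longleftrightarrow> y \<in> ?S \<and> z \<in> ?S \<and> (\<forall>i\<in>I. z \<in> G i \<or> y \<notin> C i)" for y z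
      unfolding D_def by auto
    have D_diag: "(y, y) \<in> D" if y: "y \<in> ?S" for y
      unfolding D_iff
    proof (intro conjI ballI y)
      fix i assume "i \<in> I"
      then have "C i \<subseteq> G i" using GHC[of i] I(2) by auto
      then show "y \<in> G i \<or> y \<notin> C i" by blast
    qed
    have "openin (prod_topology X X) (D \<inter> D\<inverse>)" "Id_on ?S \<subseteq> D \<inter> D\<inverse>" "D \<inter> D\<inverse> \<subseteq> ?S \<times> ?S"
      using D_open conv[OF D_open] D_diag D_sub by auto
    then have "D \<inter> D\<inverse> \<in> \<U>" unfolding \<U>_def by blast
    moreover have "(D \<inter> D\<inverse>) O (D \<inter> D\<inverse>) \<subseteq> W"
    proof clarify
      fix x y z assume *: "(x, y) \<in> D" "(y, x) \<in> D" "(y, z) \<in> D" "(z, y) \<in> D"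
      then have "y \<in> ?S" unfolding D_iff by simp
      then obtain i where i: "i \<in> I" "y \<in> H i" using I(3) by blast
      then have g: "y \<in> C i" "G i \<times> G i \<subseteq> W" using GHC[of i] I(2) by auto
      then have "x \<in> G i" "z \<in> G i"
        using *(2,3) i(1) unfolding D_iff by blast+
      then show "(x, z) \<in> W" using g(2) by blast
    qed
    ultimately show ?thesis by blast
  qed
  have uni: "uniform_structure_on ?S \<U>"
    unfolding uniform_structure_on_def
  proof (intro conjI ballI allI impI)
    show "?S \<times> ?S \<in> \<U>"
      unfolding \<U>_def using openin_topspace[of "prod_topology X X"] by auto
  next
    fix E assume E: "E \<in> \<U>"
    then obtain W where W: "openin (prod_topology X X) W" "Id_on ?S \<subseteq> W" "W \<subseteq> E"
      unfolding \<U>_def by blast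
    show "E \<subseteq> ?S \<times> ?S" using E unfolding \<U>_def by blast
    show "Id_on ?S \<subseteq> E" using W by blast
    have "Id_on ?S \<subseteq> W\<inverse>" "W\<inverse> \<subseteq> E\<inverse>" "E\<inverse> \<subseteq> ?S \<times> ?S" using W \<open>E \<subseteq> ?S \<times> ?S\<close> by auto
    then show "E\<inverse> \<in> \<U>" unfolding \<U>_def using conv[OF W(1)] by blast
    show "\<exists>D\<in>\<U>. D O D \<subseteq> E" using half[OF W(1,2)] W(3) by blast
  next
    fix D E assume "D \<in> \<U>" "D \<subseteq> E \<and> E \<subseteq> ?S \<times> ?S"
    then show "E \<in> \<U>" unfolding \<U>_def by blast
  next
    fix D E assume "D \<in> \<U>" "E \<in> \<U>"
    then obtain V W where "openin (prod_topology X X) V" "Id_on ?S \<subseteq> V" "V \<subseteq> D"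
        "openin (prod_topology X X) W" "Id_on ?S \<subseteq> W" "W \<subseteq> E" "D \<subseteq> ?S \<times> ?S"
      unfolding \<U>_def by blast
    then show "D \<inter> E \<in> \<U>"
      unfolding \<U>_def by (auto intro!: exI[of _ "V \<inter> W"])
  qed
  have "uniform_topology ?S \<U> = X"
    unfolding topology_eq openin_uniform_topology[OF uni]
  proof (intro allI iffI conjI ballI)
    fix G assume *: "G \<subseteq> ?S \<and> (\<forall>x\<in>G. \<exists>E\<in>\<U>. E `` {x} \<subseteq> G)"
    show "openin X G"
    proof (subst openin_subopen, intro ballI)
      fix x assume x: "x \<in> G"
      then have "\<exists>E\<in>\<U>. E `` {x} \<subseteq> G" using * by simp
      then obtain E where E: "E \<in> \<U>" "E `` {x} \<subseteq> G" by (elim bexE)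
      then obtain W where W: "openin (prod_topology X X) W" "Id_on ?S \<subseteq> W" "W \<subseteq> E"
        unfolding \<U>_def by blast
      have "W `` {x} \<subseteq> G" using E(2) W(3) by blast
      have "(x, x) \<in> W" using W(2) x * by auto
      then obtain A B where "openin X A" "openin X B" "x \<in> A" "x \<in> B" "A \<times> B \<subseteq> W"
        using W(1)[unfolded openin_prod_topology_alt, rule_format, OF \<open>(x, x) \<in> W\<close>]
        by (elim exE conjE)
      then show "\<exists>T. openin X T \<and> x \<in> T \<and> T \<subseteq> G"
        using \<open>W `` {x} \<subseteq> G\<close> by (intro exI[of _ B]) blast
    qed
  next
    fix G assume "openin X G"
    then show "G \<subseteq> ?S" by (rule openin_subset)
  next
    fix G x assume G: "openin X G" and x: "x \<in> G"
    let ?E = "G \<times> G \<union> (?S - {x}) \<times> ?S"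
    have GS: "G \<subseteq> ?S" using G by (rule openin_subset)
    have "closedin X {x}"
      using assms(2) x GS by (intro closedin_Hausdorff_singleton) auto
    then have "openin (prod_topology X X) ?E"
      using G by (intro openin_Un) (auto simp: openin_prod_Times_iff)
    moreover have "Id_on ?S \<subseteq> ?E" "?E \<subseteq> ?S \<times> ?S" using x GS by auto
    ultimately have "?E \<in> \<U>" unfolding \<U>_def by blast
    moreover have "?E `` {x} \<subseteq> G" by auto
    ultimately show "\<exists>E\<in>\<U>. E `` {x} \<subseteq> G" by blast
  qed
  with uni show ?thesis unfolding compatible_uniformity_def by blast
qed

end

theory Submission
  imports Defs
begin

text \<open>
  Everything rests on lifting paths. Let \<open>c\<close> be a path in \<open>X\<close> and \<open>x\<close> a point of the inverse limit
  lying over \<open>c 0\<close>. At each entourage \<open>E\<close>, extend an \<open>E\<close>-chain representing \<open>x E\<close> by the values of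
  \<open>c\<close> along a subdivision of \<open>[0, t]\<close> that is fine enough for \<open>E\<close>. The resulting class does not depend
  on the subdivision, because the interval is simply connected at every scale: chains of small steps
  in \<open>[0, 1]\<close> with the same ends are homotopic (\<open>interval_chains_homotopic\<close>), and \<open>c\<close> carries such a
  homotopy to \<open>X\<close>. So the classes are compatible under refinement of \<open>E\<close> and give a point
  \<open>path_lift \<U> x c t\<close> of the limit over \<open>c t\<close>; it varies continuously with \<open>t\<close> and starts at \<open>x\<close>
  (\<open>pathin_path_lift\<close>, \<open>path_lift_0\<close>).

  The compact set is then immediate. A Peano continuum is the image of a path starting at \<open>b\<close>, and
  the image of the lift of that path from the basepoint is compact, path connected, contains the
  basepoint and maps onto \<open>X\<close>.

  For coverability, a Peano continuum is locally path connected, being a quotient of the interval.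
  Hence every entourage \<open>F\<close> contains the entourage formed by all squares \<open>C \<times> C \<subseteq> F\<close> with \<open>C\<close> path
  connected (\<open>path_connected_core_entourage\<close>). If \<open>E\<close> has this form, each step of an \<open>E\<close>-chain is
  joined by a path inside some \<open>C\<close> with \<open>C \<times> C \<subseteq> E\<close>; all chains in \<open>C\<close> with the same ends are
  \<open>E\<close>-homotopic, so lifting that path extends the \<open>E\<close>-class by exactly the given step
  (\<open>path_lift_within\<close>). Step by step, every \<open>E\<close>-class is thus the coordinate of a point of the limit.
\<close>


section \<open>Local modifications of chains\<close>

lemma chain_homotopic_trans:
  "chain_homotopic E \<alpha> \<beta> \<Longrightarrow> chain_homotopic E \<beta> \<gamma> \<Longrightarrow> chain_homotopic E \<alpha> \<gamma>"
  by (auto simp: chain_homotopic_def)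

lemma chain_append:
  assumes "chain E \<alpha>" "chain E \<beta>" "(last \<alpha>, hd \<beta>) \<in> E"
  shows "chain E (\<alpha> @ \<beta>)"
  using assms by (auto simp: chain_def successively_append_iff)

lemma chain_homotopic_append:
  assumes "chain_homotopic E xs ys" "xs \<noteq> []" "chain E (p @ xs @ q)"
  shows "chain_homotopic E (p @ xs @ q) (p @ ys @ q)"
proof -
  have "chain_homotopic E (p @ xs @ q) (p @ ys @ q) \<and> chain E (p @ ys @ q)"
    using assms(1) unfolding chain_homotopic_def
  proof (induction rule: rtranclp_induct)
    case base
    then show ?case using assms(3) by simp
  next
    case (step ys zs)
    have yz: "ys \<noteq> []" "zs \<noteq> []" "chain E zs" "hd ys = hd zs" "last ys = last zs"
      using step.hyps(2) by (auto simp: chain_step_def chain_def)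
    have adds: "adds_point (p @ \<sigma> @ q) (p @ \<tau> @ q)" if "adds_point \<sigma> \<tau>" for \<sigma> \<tau>
      using that unfolding adds_point_def by (metis append.assoc append_Cons)
    have zs: "chain E (p @ zs @ q)"
      using step.IH yz by (auto simp: chain_def successively_append_iff)
    have "chain_step E (p @ ys @ q) (p @ zs @ q)"
      using step zs yz adds by (auto simp: chain_step_def hd_append last_append)
    with step.IH zs show ?case by auto
  qed
  then show ?thesis ..
qed

text \<open>
  A set \<open>A\<close> with \<open>A \<times> A \<subseteq> E\<close> is invisible at scale \<open>E\<close>: within it only the endpoints matter, since both
  segments contract to the two-point chain of their ends.
\<close>

lemma chain_homotopic_replace:
  assumes "chain E (p @ xs @ q)" "A \<times> A \<subseteq> E" "set xs \<subseteq> A" "set ys \<subseteq> A"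
    and "xs \<noteq> []" "ys \<noteq> []" "hd xs = hd ys" "last xs = last ys"
  shows "chain_homotopic E (p @ xs @ q) (p @ ys @ q)"
proof -
  have "chain_homotopic (A \<times> A) xs [hd xs, last xs]" "chain_homotopic (A \<times> A) ys [hd xs, last xs]"
    using chain_homotopic_full[of xs A] chain_homotopic_full[of ys A] assms by simp_all
  then have "chain_homotopic (A \<times> A) xs ys"
    by (metis chain_homotopic_sym chain_homotopic_trans)
  then have "chain_homotopic E xs ys"
    using assms(2) by (rule chain_homotopic_mono)
  then show ?thesis
    by (rule chain_homotopic_append) fact+
qed

lemma chain_map:
  assumes "chain J ts" "\<And>s t. (s, t) \<in> J \<Longrightarrow> (c s, c t) \<in> E"
  shows "chain E (map c ts)"
  using assms by (auto simp: chain_def successively_map intro: successively_mono)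

lemma chain_homotopic_map:
  assumes "chain_homotopic J ts us" "\<And>s t. (s, t) \<in> J \<Longrightarrow> (c s, c t) \<in> E"
  shows "chain_homotopic E (map c ts) (map c us)"
proof -
  have adds: "adds_point (map c \<sigma>) (map c \<tau>)" if "adds_point \<sigma> \<tau>" for \<sigma> \<tau>
    using that unfolding adds_point_def by (metis map_append list.simps(9))
  have chain: "chain E (map c \<sigma>)" "\<sigma> \<noteq> []" if "chain J \<sigma>" for \<sigma>
    using chain_map[of J \<sigma> c E] that assms(2) by (auto simp: chain_def)
  have step: "chain_step E (map c \<sigma>) (map c \<tau>)" if "chain_step J \<sigma> \<tau>" for \<sigma> \<tau>
    using that adds unfolding chain_step_def by (auto simp: hd_map last_map chain)
  show ?thesis
    using assms(1) unfolding chain_homotopic_def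
    by (induction rule: rtranclp_induct) (auto intro: rtranclp.rtrancl_into_rtrancl step)
qed


section \<open>Chains in the unit interval\<close>

definition interval_entourage :: "real \<Rightarrow> (real \<times> real) set" where
  "interval_entourage \<delta> = {(s, t). s \<in> {0..1} \<and> t \<in> {0..1} \<and> \<bar>s - t\<bar> < \<delta>}"

lemma interval_entourage_mono: "\<delta> \<le> \<epsilon> \<Longrightarrow> interval_entourage \<delta> \<subseteq> interval_entourage \<epsilon>"
  by (auto simp: interval_entourage_def)

text \<open>
  A canonical chain from \<open>0\<close> to \<open>t\<close>: the multiples of \<open>\<delta>\<close> up to \<open>t\<close>, then \<open>t\<close> itself. The endpoint is
  repeated if it is a multiple of \<open>\<delta>\<close>, which keeps the formula uniform.
\<close>

definition grid :: "real \<Rightarrow> real \<Rightarrow> real list" where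
  "grid \<delta> t = map (\<lambda>i. real i * \<delta>) [0..<Suc (nat \<lfloor>t / \<delta>\<rfloor>)] @ [t]"

lemma hd_grid: "hd (grid \<delta> t) = 0"
  by (simp add: grid_def hd_append hd_map del: upt_Suc)

lemma last_grid: "last (grid \<delta> t) = t"
  by (simp add: grid_def)

lemma floor_grid_bounds:
  assumes "0 < \<delta>" "0 \<le> t"
  shows "real (nat \<lfloor>t / \<delta>\<rfloor>) * \<delta> \<le> t" "t < real (nat \<lfloor>t / \<delta>\<rfloor>) * \<delta> + \<delta>"
proof -
  have k: "real (nat \<lfloor>t / \<delta>\<rfloor>) = of_int \<lfloor>t / \<delta>\<rfloor>" using assms by simp
  have "of_int \<lfloor>t / \<delta>\<rfloor> \<le> t / \<delta>" "t / \<delta> < of_int \<lfloor>t / \<delta>\<rfloor> + 1" by linarith+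
  moreover have "r * \<delta> \<le> t" "t < r * \<delta> + \<delta>" if "r \<le> t / \<delta>" "t / \<delta> < r + 1" for r
    using that assms(1) by (simp_all add: field_simps)
  ultimately show "real (nat \<lfloor>t / \<delta>\<rfloor>) * \<delta> \<le> t" "t < real (nat \<lfloor>t / \<delta>\<rfloor>) * \<delta> + \<delta>"
    unfolding k by blast+
qed

text \<open>
  The last gap may be short and all gaps are at most \<open>\<delta>\<close>; the strict bound in \<open>interval_entourage\<close>
  is the reason for the scale \<open>2 * \<delta>\<close>, which is also the one at which homotopies take place.
\<close>

lemma chain_grid:
  assumes "0 < \<delta>" "t \<in> {0..1}"
  shows "chain (interval_entourage (2 * \<delta>)) (grid \<delta> t)"
proof -
  have grid: "chain (interval_entourage (2 * \<delta>)) (map (\<lambda>i. real i * \<delta>) [0..<Suc k])"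
    if "real k * \<delta> \<le> 1" for k
    using that
  proof (induction k)
    case 0
    then show ?case by (simp add: chain_def)
  next
    case (Suc k)
    have "(real k * \<delta>, real (Suc k) * \<delta>) \<in> interval_entourage (2 * \<delta>)"
      using Suc.prems assms(1) by (auto simp: interval_entourage_def algebra_simps)
    moreover have "chain (interval_entourage (2 * \<delta>)) (map (\<lambda>i. real i * \<delta>) [0..<Suc k])"
      using Suc assms(1) by (simp add: algebra_simps)
    moreover have "map (\<lambda>i. real i * \<delta>) [0..<Suc (Suc k)] =
        map (\<lambda>i. real i * \<delta>) [0..<Suc k] @ [real (Suc k) * \<delta>]" by simp
    ultimately show ?case
      by (simp add: chain_snoc last_map del: upt_Suc append_assoc)
  qed
  let ?k = "nat \<lfloor>t / \<delta>\<rfloor>"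
  have b: "real ?k * \<delta> \<le> t" "t < real ?k * \<delta> + \<delta>"
    using floor_grid_bounds[OF assms(1)] assms(2) by auto
  moreover have "0 \<le> real ?k * \<delta>" using assms(1) by simp
  moreover have in_I: "(r, t) \<in> interval_entourage (2 * \<delta>)" if "r \<le> t" "t < r + \<delta>" "0 \<le> r" for r
    using that assms by (auto simp: interval_entourage_def)
  ultimately have "(real ?k * \<delta>, t) \<in> interval_entourage (2 * \<delta>)"
    using in_I[of "real ?k * \<delta>"] by blast
  moreover have "chain (interval_entourage (2 * \<delta>)) (map (\<lambda>i. real i * \<delta>) [0..<Suc ?k])"
    using b assms(2) by (intro grid order_trans[OF b(1)]) simp
  ultimately show ?thesis
    unfolding grid_def by (simp add: chain_snoc last_map del: upt_Suc of_nat_nat)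
qed

text \<open>
  The two chains agree up to the last grid point below \<open>t\<close>. Everything after it lies in an
  interval of length less than \<open>2 * \<delta>\<close>, because \<open>t\<close> is within \<open>\<delta>\<close> of that grid point and \<open>t'\<close> within
  \<open>\<delta>\<close> of \<open>t\<close>, so the tails may be exchanged.
\<close>

lemma grid_append_homotopic_le:
  assumes "0 < \<delta>" "(t, t') \<in> interval_entourage \<delta>" "t \<le> t'"
  shows "chain_homotopic (interval_entourage (2 * \<delta>)) (grid \<delta> t @ [t']) (grid \<delta> t')"
proof -
  have t: "0 \<le> t" "t \<le> 1" "0 \<le> t'" "t' \<le> 1" "t' < t + \<delta>"
    using assms by (auto simp: interval_entourage_def)
  define k k' where "k = nat \<lfloor>t / \<delta>\<rfloor>" and "k' = nat \<lfloor>t' / \<delta>\<rfloor>"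
  note k = floor_grid_bounds[OF assms(1) t(1), folded k_def]
  note k' = floor_grid_bounds[OF assms(1) t(3), folded k'_def]
  have "k \<le> k'"
    unfolding k_def k'_def using assms(1,3) by (intro nat_mono floor_mono divide_right_mono) auto
  let ?f = "\<lambda>i. real i * \<delta>" and ?A = "{real k * \<delta>..t'}"
  have split: "[0..<Suc k] = [0..<k] @ [k]" "[0..<Suc k'] = [0..<k] @ [k..<Suc k']"
    using \<open>k \<le> k'\<close> upt_add_eq_append[of 0 k "Suc k' - k"] by auto
  have l: "grid \<delta> t @ [t'] = map ?f [0..<k] @ [?f k, t, t'] @ []"
    unfolding grid_def k_def[symmetric] split by simp
  have r: "grid \<delta> t' = map ?f [0..<k] @ (map ?f [k..<Suc k'] @ [t']) @ []"
    unfolding grid_def k'_def[symmetric] split by simp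
  have "chain (interval_entourage (2 * \<delta>)) (grid \<delta> t @ [t'])"
    using chain_grid[OF assms(1), of t] t assms
    by (subst chain_snoc) (auto simp: last_grid chain_def interval_entourage_def)
  then show ?thesis
    unfolding l r
  proof (rule chain_homotopic_replace)
    have "0 \<le> a" if "?f k \<le> a" for a
      using assms(1) that by (intro order_trans[OF _ that]) simp
    then show "?A \<times> ?A \<subseteq> interval_entourage (2 * \<delta>)"
      using k t by (auto simp: interval_entourage_def)
    show "set [?f k, t, t'] \<subseteq> ?A"
      using k assms(3) by auto
    have "?f i \<le> t'" if "i \<le> k'" for i
      using k'(1) that assms(1) by (meson mult_right_mono of_nat_mono order_less_imp_le order_trans)
    then show "set (map ?f [k..<Suc k'] @ [t']) \<subseteq> ?A"
      using k assms(1,3) by (auto intro: mult_right_mono)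
    show "hd [?f k, t, t'] = hd (map ?f [k..<Suc k'] @ [t'])"
      using \<open>k \<le> k'\<close> by (simp add: hd_append hd_map del: upt_Suc)
  qed auto
qed

text \<open>
  A step backwards reduces to a step forwards: \<open>grid \<delta> t\<close> may be replaced by \<open>grid \<delta> t' @ [t]\<close>, and
  the excursion from \<open>t'\<close> to \<open>t\<close> and back is then removed.
\<close>

lemma grid_append_homotopic:
  assumes "0 < \<delta>" "(t, t') \<in> interval_entourage \<delta>"
  shows "chain_homotopic (interval_entourage (2 * \<delta>)) (grid \<delta> t @ [t']) (grid \<delta> t')"
proof (cases "t \<le> t'")
  case True
  with assms show ?thesis by (rule grid_append_homotopic_le)
next
  case False
  let ?I = "interval_entourage (2 * \<delta>)"
  have t: "0 \<le> t" "t \<le> 1" "0 \<le> t'" "t' \<le> 1" "t < t' + \<delta>" "t' < t"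
    using assms False by (auto simp: interval_entourage_def)
  have I: "(t', t) \<in> ?I" "(t, t') \<in> ?I" "(t', t') \<in> ?I" "(t, t) \<in> ?I"
    using t assms(1) by (auto simp: interval_entourage_def)
  have c: "chain ?I (grid \<delta> t' @ [t])"
    using chain_grid[OF assms(1), of t'] t I(1) by (subst chain_snoc) (auto simp: last_grid chain_def)
  define g where "g = map (\<lambda>i. real i * \<delta>) [0..<Suc (nat \<lfloor>t' / \<delta>\<rfloor>)]"
  have g: "grid \<delta> t' = g @ [t']" by (simp add: grid_def g_def)
  have c': "chain ?I (g @ [t', t, t'] @ [])"
    using c I chain_snoc[of "grid \<delta> t' @ [t]" ?I t'] by (simp add: g)
  have "chain_homotopic ?I (grid \<delta> t' @ [t]) (grid \<delta> t)"
    using assms t by (intro grid_append_homotopic_le) (auto simp: interval_entourage_def)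
  from chain_homotopic_snoc[OF this c, of t']
  have 1: "chain_homotopic ?I (g @ [t', t, t'] @ []) (grid \<delta> t @ [t'])"
    using I by (simp add: g)
  have "chain_homotopic ?I (g @ [t', t, t'] @ []) (g @ [t'] @ [])"
    using I by (intro chain_homotopic_replace[OF c', of "{t, t'}"]) auto
  then have 2: "chain_homotopic ?I (g @ [t', t, t'] @ []) (grid \<delta> t')"
    by (simp add: g)
  show ?thesis
    using 1 2 chain_homotopic_sym chain_homotopic_trans by metis
qed

text \<open>
  Induction along the chain, moving the canonical chain with its endpoint one step at a time.
  This is the simple connectedness of the interval at scale \<open>\<delta>\<close>; doubling the scale for the homotopies
  costs nothing in the applications and avoids sorting the chain.
\<close>

lemma interval_chain_homotopic_grid:
  assumes "0 < \<delta>" "chain (interval_entourage \<delta>) ts" "hd ts = 0"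
  shows "chain_homotopic (interval_entourage (2 * \<delta>)) ts (grid \<delta> (last ts))"
proof -
  let ?I = "interval_entourage (2 * \<delta>)"
  have sub: "interval_entourage \<delta> \<subseteq> ?I"
    using assms(1) by (intro interval_entourage_mono) simp
  have "ts \<noteq> []" using assms(2) by (simp add: chain_def)
  then show ?thesis
    using assms(2,3)
  proof (induction ts rule: rev_nonempty_induct)
    case (single t)
    have "chain_homotopic ?I ([] @ [0] @ []) ([] @ [0, 0] @ [])"
      using assms(1)
      by (intro chain_homotopic_replace[of _ _ _ _ "{0}"])
        (auto simp: chain_def interval_entourage_def)
    then show ?case using single by (simp add: grid_def)
  next
    case (snoc t ts)
    have ts: "chain (interval_entourage \<delta>) ts" "(last ts, t) \<in> interval_entourage \<delta>" "hd ts = 0"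
      using snoc.prems snoc.hyps by (auto simp: chain_snoc)
    have "chain_homotopic ?I (ts @ [t]) (grid \<delta> (last ts) @ [t])"
      using snoc.IH ts sub by (intro chain_homotopic_snoc) (auto intro: chain_mono)
    moreover have "chain_homotopic ?I (grid \<delta> (last ts) @ [t]) (grid \<delta> t)"
      using assms(1) ts(2) by (rule grid_append_homotopic)
    ultimately show ?case by (simp add: chain_homotopic_trans)
  qed
qed

lemma interval_chains_homotopic:
  assumes "0 < \<delta>" "chain (interval_entourage \<delta>) ts" "chain (interval_entourage \<delta>) us"
    and "hd ts = 0" "hd us = 0" "last ts = last us"
  shows "chain_homotopic (interval_entourage (2 * \<delta>)) ts us"
  using interval_chain_homotopic_grid[OF assms(1,2,4)] interval_chain_homotopic_grid[OF assms(1,3,5)]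
  by (metis assms(6) chain_homotopic_sym chain_homotopic_trans)

lemma ex_interval_chain:
  assumes "0 < \<delta>" "t \<in> {0..1}"
  obtains ts where "chain (interval_entourage \<delta>) ts" "hd ts = 0" "last ts = t"
  using chain_grid[of "\<delta> / 2" t] assms hd_grid[of "\<delta> / 2" t] last_grid[of "\<delta> / 2" t] by auto


section \<open>Entourages, neighbourhoods and Lebesgue numbers\<close>

lemma entourage_subset:
  assumes "uniform_structure_on S \<U>" "E \<in> entourages \<U>"
  shows "E \<subseteq> S \<times> S"
  using assms(2) by (intro uniform_structure_subset[OF assms(1)]) (simp add: entourages_def)

lemma entourage_refl:
  assumes "uniform_structure_on S \<U>" "E \<in> entourages \<U>" "x \<in> S"
  shows "(x, x) \<in> E"
proof -
  have "Id_on S \<subseteq> E"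
    using assms(2) by (intro uniform_structure_diag[OF assms(1)]) (simp add: entourages_def)
  with assms(3) show ?thesis by blast
qed

lemma full_entourage:
  assumes "uniform_structure_on S \<U>"
  shows "S \<times> S \<in> entourages \<U>"
  using uniform_structure_full[OF assms] by (auto simp: entourages_def sym_def)

lemma uniform_structure_entourage_half:
  assumes "uniform_structure_on S \<U>" "E \<in> \<U>"
  obtains D where "D \<in> entourages \<U>" "D O D \<subseteq> E"
proof -
  have "E \<inter> E\<inverse> \<in> \<U>"
    by (rule uniform_structure_Int[OF assms uniform_structure_converse[OF assms]])
  moreover have "sym (E \<inter> E\<inverse>)" by (auto simp: sym_def)
  ultimately have "E \<inter> E\<inverse> \<in> entourages \<U>" by (simp add: entourages_def)
  from entourage_half[OF assms(1) this]
  obtain D where "D \<in> entourages \<U>" "D O D \<subseteq> E \<inter> E\<inverse>" by metis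
  then show thesis by (intro that[of D]) simp_all
qed

text \<open>
  The set of points having some entourage neighbourhood inside \<open>D `` {x}\<close> is open, by halving
  entourages.
\<close>

lemma uniform_neighbourhood:
  assumes U: "uniform_structure_on S \<U>" and D: "D \<in> \<U>" and x: "x \<in> S"
  obtains G where "openin (uniform_topology S \<U>) G" "x \<in> G" "G \<subseteq> D `` {x}"
proof -
  define G where "G = {y \<in> S. \<exists>F\<in>\<U>. F `` {y} \<subseteq> D `` {x}}"
  have diag: "(y, y) \<in> F" if "F \<in> \<U>" "y \<in> S" for F y
    using uniform_structure_diag[OF U that(1)] that(2) by auto
  have "\<exists>F\<in>\<U>. F `` {y} \<subseteq> G" if "y \<in> G" for y
  proof -
    obtain F where F: "F \<in> \<U>" "F `` {y} \<subseteq> D `` {x}"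
      using \<open>y \<in> G\<close> by (auto simp: G_def)
    obtain F' where F': "F' \<in> \<U>" "F' O F' \<subseteq> F"
      using uniform_structure_half[OF U F(1)] by blast
    have "F' `` {y} \<subseteq> G"
    proof
      fix z assume z: "z \<in> F' `` {y}"
      then have "F' `` {z} \<subseteq> D `` {x}" using F'(2) F(2) by blast
      moreover have "z \<in> S" using z uniform_structure_subset[OF U F'(1)] by auto
      ultimately show "z \<in> G" using F'(1) by (auto simp: G_def)
    qed
    with F'(1) show ?thesis by blast
  qed
  moreover have "G \<subseteq> S" unfolding G_def by (rule Collect_restrict)
  ultimately have "openin (uniform_topology S \<U>) G"
    unfolding openin_uniform_topology[OF U] by simp
  moreover have "x \<in> G" using D x unfolding G_def by blast
  moreover have "G \<subseteq> D `` {x}"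
  proof
    fix y assume "y \<in> G"
    then obtain F where "F \<in> \<U>" "F `` {y} \<subseteq> D `` {x}" "y \<in> S" unfolding G_def by blast
    with diag[of F y] show "y \<in> D `` {x}" by blast
  qed
  ultimately show thesis by (rule that)
qed

text \<open>
  The covering form of the Lebesgue number lemma. Around each \<open>x\<close>, halving gives an entourage that
  serves a whole neighbourhood of \<open>x\<close>; finitely many neighbourhoods suffice, and the intersection of
  their entourages works everywhere.
\<close>

lemma uniform_Lebesgue:
  assumes X: "compatible_uniformity X \<U>" "compact_space X"
    and \<C>: "\<And>C. C \<in> \<C> \<Longrightarrow> openin X C" "topspace X \<subseteq> \<Union>\<C>"
  obtains D where "D \<in> \<U>" "\<And>x. x \<in> topspace X \<Longrightarrow> \<exists>C\<in>\<C>. D `` {x} \<subseteq> C"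
proof -
  let ?S = "topspace X"
  have U: "uniform_structure_on ?S \<U>" and top: "uniform_topology ?S \<U> = X"
    using X(1) by (simp_all add: compatible_uniformity_def)
  have "\<exists>D G C. D \<in> \<U> \<and> openin X G \<and> x \<in> G \<and> C \<in> \<C> \<and> (\<forall>y\<in>G. D `` {y} \<subseteq> C)" if x: "x \<in> ?S" for x
  proof -
    obtain C where C: "C \<in> \<C>" "x \<in> C" using \<C>(2) x by blast
    have "openin (uniform_topology ?S \<U>) C" using \<C>(1)[OF C(1)] top by simp
    then obtain E where E: "E \<in> \<U>" "E `` {x} \<subseteq> C"
      using C(2) openin_uniform_topology[OF U] by auto
    obtain D where D: "D \<in> \<U>" "D O D \<subseteq> E"
      using uniform_structure_half[OF U E(1)] by blast
    obtain G where G: "openin X G" "x \<in> G" "G \<subseteq> D `` {x}"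
      using uniform_neighbourhood[OF U D(1) x] top by metis
    have "\<forall>y\<in>G. D `` {y} \<subseteq> C" using G(3) D(2) E(2) by blast
    with C(1) D(1) G(1,2) show ?thesis by (intro exI[of _ D] exI[of _ G] exI[of _ C]) simp
  qed
  then obtain D G C where *: "\<And>x. x \<in> ?S \<Longrightarrow> D x \<in> \<U>" "\<And>x. x \<in> ?S \<Longrightarrow> openin X (G x)"
      "\<And>x. x \<in> ?S \<Longrightarrow> x \<in> G x" "\<And>x. x \<in> ?S \<Longrightarrow> C x \<in> \<C>"
      "\<And>x y. x \<in> ?S \<Longrightarrow> y \<in> G x \<Longrightarrow> D x `` {y} \<subseteq> C x"
    by metis
  have "\<exists>\<F>. finite \<F> \<and> \<F> \<subseteq> G ` ?S \<and> ?S \<subseteq> \<Union>\<F>"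
    using *(2,3) by (intro X(2)[unfolded compact_space_alt, rule_format]) auto
  then obtain I where I: "finite I" "I \<subseteq> ?S" "?S \<subseteq> \<Union>(G ` I)"
    by (metis finite_subset_image)
  let ?D = "?S \<times> ?S \<inter> (\<Inter>i\<in>I. D i)"
  have "?D \<in> \<U>"
    using I(1,2)
  proof (induction I rule: finite_induct)
    case empty
    then show ?case using uniform_structure_full[OF U] by simp
  next
    case (insert i I)
    then have "D i \<in> \<U>" "?S \<times> ?S \<inter> (\<Inter>i\<in>I. D i) \<in> \<U>" using *(1) by auto
    then have "D i \<inter> (?S \<times> ?S \<inter> (\<Inter>i\<in>I. D i)) \<in> \<U>"
      by (rule uniform_structure_Int[OF U])
    then show ?case by (simp add: Int_ac)
  qed
  moreover have "\<exists>C\<in>\<C>. ?D `` {x} \<subseteq> C" if x: "x \<in> ?S" for x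
  proof -
    obtain i where i: "i \<in> I" "x \<in> G i" using I(3) x by blast
    then have "D i `` {x} \<subseteq> C i" "C i \<in> \<C>" using *(4,5) I(2) by auto
    with i(1) show ?thesis by blast
  qed
  ultimately show thesis by (rule that)
qed

text \<open>
  The factor \<open>2\<close> matches \<open>interval_chains_homotopic\<close>: if \<open>\<delta>\<close> is fine for \<open>E\<close>, then \<open>c\<close> sends homotopies
  between chains of step less than \<open>\<delta>\<close> to \<open>E\<close>-homotopies.
\<close>

definition fine_for :: "(real \<Rightarrow> 'a) \<Rightarrow> ('a \<times> 'a) set \<Rightarrow> real \<Rightarrow> bool" where
  "fine_for c E \<delta> \<longleftrightarrow> 0 < \<delta> \<and> (\<forall>s t. (s, t) \<in> interval_entourage (2 * \<delta>) \<longrightarrow> (c s, c t) \<in> E)"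

lemma fine_for_mono: "fine_for c D \<delta> \<Longrightarrow> D \<subseteq> E \<Longrightarrow> fine_for c E \<delta>"
  by (auto simp: fine_for_def)

text \<open>
  Uniform continuity of paths, by the Lebesgue number of the cover of \<open>[0, 1]\<close> given by continuity at
  each point.
\<close>

lemma ex_fine_for:
  assumes X: "compatible_uniformity X \<U>" and c: "pathin X c" and E: "E \<in> \<U>"
  obtains \<delta> where "fine_for c E \<delta>"
proof -
  let ?S = "topspace X"
  have U: "uniform_structure_on ?S \<U>" and top: "uniform_topology ?S \<U> = X"
    using X by (simp_all add: compatible_uniformity_def)
  obtain D where D: "D \<in> entourages \<U>" "D O D \<subseteq> E"
    using uniform_structure_entourage_half[OF U E] .
  have cS: "c s \<in> ?S" if "s \<in> {0..1}" for s
    using c that by (auto simp: pathin_def continuous_map_def)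
  have "\<exists>e>0. \<forall>s'\<in>{0..1}. dist s' s < e \<longrightarrow> (c s, c s') \<in> D" if s: "s \<in> {0..1}" for s
  proof -
    obtain G where G: "openin X G" "c s \<in> G" "G \<subseteq> D `` {c s}"
      using uniform_neighbourhood[OF U _ cS[OF s], of D] D(1) top by (auto simp: entourages_def)
    have "openin (top_of_set {0..1}) {s' \<in> {0..1}. c s' \<in> G}"
      using openin_continuous_map_preimage[OF c[unfolded pathin_def] G(1)] by simp
    then obtain e where "e > 0" "\<forall>s'\<in>{0..1}. dist s' s < e \<longrightarrow> c s' \<in> G"
      unfolding openin_euclidean_subtopology_iff using G(2) s by auto
    with G(3) show ?thesis by blast
  qed
  then obtain e where e: "\<And>s. s \<in> {0..1} \<Longrightarrow> e s > 0"
      "\<And>s s'. s \<in> {0..1} \<Longrightarrow> s' \<in> {0..1} \<Longrightarrow> dist s' s < e s \<Longrightarrow> (c s, c s') \<in> D"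
    by metis
  have "{0..1} \<subseteq> \<Union>((\<lambda>s. ball s (e s)) ` {0..1})" using e(1) by force
  from Heine_Borel_lemma[OF compact_Icc this]
  obtain \<eta> where \<eta>: "\<eta> > 0"
      "\<And>s. s \<in> {0..1} \<Longrightarrow> \<exists>B\<in>(\<lambda>s. ball s (e s)) ` {0..1}. ball s \<eta> \<subseteq> B"
    by auto
  have "(c s, c t) \<in> E" if st: "(s, t) \<in> interval_entourage \<eta>" for s t
  proof -
    have s: "s \<in> {0..1}" "t \<in> {0..1}" "t \<in> ball s \<eta>" "s \<in> ball s \<eta>"
      using st \<eta>(1) by (auto simp: interval_entourage_def dist_real_def)
    then obtain r where "r \<in> {0..1}" "ball s \<eta> \<subseteq> ball r (e r)" using \<eta>(2) by blast
    with s have "r \<in> {0..1}" "s \<in> ball r (e r)" "t \<in> ball r (e r)" by blast+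
    then have "(c r, c s) \<in> D" "(c r, c t) \<in> D"
      using e(2)[of r] s(1,2) by (simp_all add: dist_commute)
    moreover have "sym D" using D(1) by (simp add: entourages_def)
    ultimately show ?thesis using D(2) by (blast dest: symD)
  qed
  with \<eta>(1) show thesis by (intro that[of "\<eta> / 2"]) (simp add: fine_for_def)
qed


section \<open>Lifting paths to the inverse limit\<close>

text \<open>
  All coordinates of a limit point end at the same point of \<open>X\<close>, since each of them maps to the
  coordinate at the full entourage.
\<close>

lemma limit_space_representative:
  assumes U: "uniform_structure_on S \<U>" and x: "x \<in> limit_space \<U> b" and E: "E \<in> entourages \<U>"
  obtains \<alpha> where "x E = chain_class E \<alpha>" "chain E \<alpha>" "hd \<alpha> = b"
    "last \<alpha> = universal_covering_map S x"
proof -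
  have "x E \<in> chain_space b E" using x E unfolding limit_space_def by blast
  then obtain \<alpha> where \<alpha>: "x E = chain_class E \<alpha>" "chain E \<alpha>" "hd \<alpha> = b"
    by (auto simp: chain_space_def)
  have "x (S \<times> S) = bonding_map (S \<times> S) (x E)"
    using x E full_entourage[OF U] entourage_subset[OF U E] unfolding limit_space_def by simp
  also have "\<dots> = chain_class (S \<times> S) \<alpha>"
    unfolding \<alpha>(1) by (rule bonding_map_chain_class[OF entourage_subset[OF U E]])
  finally have "x (S \<times> S) = chain_class (S \<times> S) \<alpha>" .
  then have "last \<alpha> = universal_covering_map S x"
    by (simp add: universal_covering_map_def class_endpoint_chain_class)
  with \<alpha> show thesis by (rule that)
qed

text \<open>
  The choices of representative and of mesh do not matter, by \<open>path_lift_eq\<close>. Half the mesh is used so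
  that the grid is a chain of step less than the mesh itself.
\<close>

definition path_lift :: "('a \<times> 'a) set set \<Rightarrow> (('a \<times> 'a) set \<Rightarrow> 'a list set) \<Rightarrow> (real \<Rightarrow> 'a) \<Rightarrow> real \<Rightarrow>
    ('a \<times> 'a) set \<Rightarrow> 'a list set" where
  "path_lift \<U> x c t = (\<lambda>E\<in>entourages \<U>. chain_class E
     ((SOME \<alpha>. \<alpha> \<in> x E) @ map c (grid ((SOME \<delta>. fine_for c E \<delta>) / 2) t)))"

text \<open>
  Two chains of different fineness are compared through a third one that is fine enough for both
  meshes: each of the two is homotopic to it at its own scale.
\<close>

lemma path_lift_eq:
  assumes E: "E \<in> entourages \<U>" and \<delta>: "fine_for c E \<delta>"
    and \<alpha>: "x E = chain_class E \<alpha>" "chain E \<alpha>" "last \<alpha> = c 0"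
    and ts: "chain (interval_entourage \<delta>) ts" "hd ts = 0" "last ts = t" and t: "t \<in> {0..1}"
  shows "path_lift \<U> x c t E = chain_class E (\<alpha> @ map c ts)"
proof -
  define \<beta> where "\<beta> = (SOME \<alpha>. \<alpha> \<in> x E)"
  define \<delta>' where "\<delta>' = (SOME \<delta>. fine_for c E \<delta>)"
  have \<delta>': "fine_for c E \<delta>'" unfolding \<delta>'_def using \<delta> by (rule someI)
  have \<alpha>\<beta>: "chain_homotopic E \<alpha> \<beta>" unfolding \<beta>_def \<alpha>(1) by (rule some_in_chain_class)
  define us where "us = grid (\<delta>' / 2) t"
  have us: "chain (interval_entourage \<delta>') us" "hd us = 0" "last us = t"
    using \<delta>' t chain_grid[of "\<delta>' / 2" t] by (simp_all add: us_def fine_for_def hd_grid last_grid)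
  have pos: "0 < min \<delta> \<delta>'" using \<delta> \<delta>' by (simp add: fine_for_def)
  then obtain vs where vs: "chain (interval_entourage (min \<delta> \<delta>')) vs" "hd vs = 0" "last vs = t"
    using ex_interval_chain[OF _ t] by metis
  have hom: "chain_homotopic E (map c ws) (map c vs)"
    if \<epsilon>: "fine_for c E \<epsilon>" "min \<delta> \<delta>' \<le> \<epsilon>" and "chain (interval_entourage \<epsilon>) ws" "hd ws = 0" "last ws = t"
    for \<epsilon> ws
  proof -
    have "chain (interval_entourage \<epsilon>) vs"
      using vs(1) interval_entourage_mono[OF \<epsilon>(2)] by (rule chain_mono)
    then have "chain_homotopic (interval_entourage (2 * \<epsilon>)) ws vs"
      using that vs by (intro interval_chains_homotopic) (auto simp: fine_for_def)
    then show ?thesis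
      by (rule chain_homotopic_map) (use \<epsilon>(1) in \<open>simp add: fine_for_def\<close>)
  qed
  have ts_us: "chain_homotopic E (map c ts) (map c us)"
    by (rule chain_homotopic_trans[OF hom[OF \<delta> min.cobounded1 ts]
          chain_homotopic_sym[OF hom[OF \<delta>' min.cobounded2 us]]])
  have sub: "interval_entourage \<delta> \<subseteq> interval_entourage (2 * \<delta>)"
    using \<delta> by (intro interval_entourage_mono) (simp add: fine_for_def)
  have cts: "chain E (map c ts)"
    using ts(1) by (rule chain_map) (use \<delta> sub in \<open>auto simp: fine_for_def\<close>)
  have "(c 0, c 0) \<in> E" using \<delta> by (auto simp: fine_for_def interval_entourage_def)
  then have ch: "chain E (\<alpha> @ map c ts)"
    using \<alpha> cts ts(1,2) by (intro chain_append) (auto simp: hd_map chain_def)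
  have ne: "\<alpha> \<noteq> []" "map c ts \<noteq> []" using \<alpha>(2) cts by (auto simp: chain_def)
  have "chain_homotopic E ([] @ \<alpha> @ map c ts) ([] @ \<beta> @ map c ts)"
    using \<alpha>\<beta> ne(1) by (rule chain_homotopic_append) (use ch in simp)
  then have 1: "chain_homotopic E (\<alpha> @ map c ts) (\<beta> @ map c ts)" by simp
  have "chain_homotopic E (\<beta> @ map c ts @ []) (\<beta> @ map c us @ [])"
    using ts_us ne(2) by (rule chain_homotopic_append) (simp add: chain_homotopic_chain[OF 1 ch])
  then have "chain_homotopic E (\<beta> @ map c ts) (\<beta> @ map c us)" by simp
  with 1 have "chain_homotopic E (\<alpha> @ map c ts) (\<beta> @ map c us)"
    by (rule chain_homotopic_trans)
  then have "chain_class E (\<beta> @ map c us) = chain_class E (\<alpha> @ map c ts)"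
    unfolding chain_class_eq_iff by (rule chain_homotopic_sym)
  then show ?thesis
    using E by (simp add: path_lift_def flip: \<beta>_def \<delta>'_def us_def)
qed

text \<open>
  The lift is taken from an arbitrary point \<open>x\<close> over \<open>c 0\<close>, not only from the basepoint. Lifts along
  successive paths can then be taken one after the other without concatenating the paths.
\<close>

context
  fixes X :: "'a topology" and \<U> :: "('a \<times> 'a) set set" and b :: 'a
    and x :: "('a \<times> 'a) set \<Rightarrow> 'a list set" and c :: "real \<Rightarrow> 'a"
  assumes X: "compatible_uniformity X \<U>"
    and x: "x \<in> limit_space \<U> b"
    and c: "pathin X c" "c 0 = universal_covering_map (topspace X) x"
begin

private lemma uniform: "uniform_structure_on (topspace X) \<U>"
  using X by (simp add: compatible_uniformity_def)

lemma path_lift_representative: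
  assumes "D \<in> entourages \<U>" "t \<in> {0..1}"
  obtains \<delta> \<alpha> ts where "fine_for c D \<delta>" "x D = chain_class D \<alpha>" "chain D \<alpha>" "hd \<alpha> = b" "last \<alpha> = c 0"
    "chain (interval_entourage \<delta>) ts" "hd ts = 0" "last ts = t"
proof -
  obtain \<delta> where \<delta>: "fine_for c D \<delta>"
    using ex_fine_for[OF X c(1)] assms(1) by (auto simp: entourages_def)
  obtain \<alpha> where \<alpha>: "x D = chain_class D \<alpha>" "chain D \<alpha>" "hd \<alpha> = b" "last \<alpha> = c 0"
    using limit_space_representative[OF uniform x assms(1)] c(2) by metis
  obtain ts where "chain (interval_entourage \<delta>) ts" "hd ts = 0" "last ts = t"
    using ex_interval_chain[OF _ assms(2)] \<delta> by (auto simp: fine_for_def)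
  with \<delta> \<alpha> show thesis by (rule that)
qed

lemma fine_chain_image:
  assumes "fine_for c D \<delta>" "chain (interval_entourage \<delta>) ts"
  shows "chain D (map c ts)"
  using assms(2)
proof (rule chain_map)
  have "interval_entourage \<delta> \<subseteq> interval_entourage (2 * \<delta>)"
    using assms(1) by (intro interval_entourage_mono) (simp add: fine_for_def)
  then show "(c s, c t) \<in> D" if "(s, t) \<in> interval_entourage \<delta>" for s t
    using that assms(1) by (auto simp: fine_for_def)
qed

lemma chain_append_path:
  assumes "D \<in> entourages \<U>" "fine_for c D \<delta>" "chain D \<alpha>" "last \<alpha> = c 0"
    "chain (interval_entourage \<delta>) ts" "hd ts = 0"
  shows "chain D (\<alpha> @ map c ts)"
proof (rule chain_append)
  show "chain D (map c ts)" using assms(2,5) by (rule fine_chain_image)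
  have "c 0 \<in> topspace X" using c(1) by (auto simp: pathin_def continuous_map_def)
  then show "(last \<alpha>, hd (map c ts)) \<in> D"
    using assms entourage_refl[OF uniform assms(1)] by (simp add: hd_map chain_def)
qed fact

lemma path_lift_in_limit_space:
  assumes t: "t \<in> {0..1}"
  shows "path_lift \<U> x c t \<in> limit_space \<U> b"
  unfolding limit_space_def
proof (intro CollectI conjI PiE_I ballI impI)
  fix E assume E: "E \<in> entourages \<U>"
  obtain \<delta> \<alpha> ts where *: "fine_for c E \<delta>" "x E = chain_class E \<alpha>" "chain E \<alpha>" "hd \<alpha> = b"
      "last \<alpha> = c 0" "chain (interval_entourage \<delta>) ts" "hd ts = 0" "last ts = t"
    using path_lift_representative[OF E t] .
  have "path_lift \<U> x c t E = chain_class E (\<alpha> @ map c ts)"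
    using E * t by (intro path_lift_eq)
  moreover have "chain E (\<alpha> @ map c ts)" using E * by (intro chain_append_path)
  moreover have "hd (\<alpha> @ map c ts) = b" using * by (simp add: chain_def)
  ultimately show "path_lift \<U> x c t E \<in> chain_space b E" by (auto simp: chain_space_def)
next
  fix E assume "E \<notin> entourages \<U>"
  then show "path_lift \<U> x c t E = undefined" by (simp add: path_lift_def)
next
  fix D E assume D: "D \<in> entourages \<U>" and E: "E \<in> entourages \<U>" and DE: "D \<subseteq> E"
  obtain \<delta> \<alpha> ts where *: "fine_for c D \<delta>" "x D = chain_class D \<alpha>" "chain D \<alpha>" "hd \<alpha> = b"
      "last \<alpha> = c 0" "chain (interval_entourage \<delta>) ts" "hd ts = 0" "last ts = t"
    using path_lift_representative[OF D t] .
  have "path_lift \<U> x c t D = chain_class D (\<alpha> @ map c ts)"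
    using D * t by (intro path_lift_eq)
  moreover have "bonding_map E (x D) = x E" using x D E DE unfolding limit_space_def by blast
  then have "x E = chain_class E \<alpha>" unfolding *(2) bonding_map_chain_class[OF DE] by (rule sym)
  then have "path_lift \<U> x c t E = chain_class E (\<alpha> @ map c ts)"
    using E * t fine_for_mono[OF *(1) DE] chain_mono[OF *(3) DE] by (intro path_lift_eq)
  ultimately show "bonding_map E (path_lift \<U> x c t D) = path_lift \<U> x c t E"
    by (simp add: bonding_map_chain_class[OF DE])
qed

lemma universal_covering_map_path_lift:
  assumes t: "t \<in> {0..1}"
  shows "universal_covering_map (topspace X) (path_lift \<U> x c t) = c t"
proof -
  let ?E = "topspace X \<times> topspace X"
  have E: "?E \<in> entourages \<U>" by (rule full_entourage[OF uniform])
  obtain \<delta> \<alpha> ts where *: "fine_for c ?E \<delta>" "x ?E = chain_class ?E \<alpha>" "chain ?E \<alpha>" "hd \<alpha> = b"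
      "last \<alpha> = c 0" "chain (interval_entourage \<delta>) ts" "hd ts = 0" "last ts = t"
    using path_lift_representative[OF E t] .
  have "path_lift \<U> x c t ?E = chain_class ?E (\<alpha> @ map c ts)"
    using E * t by (intro path_lift_eq)
  moreover have "last (\<alpha> @ map c ts) = c t" using * by (simp add: chain_def last_map)
  ultimately show ?thesis
    by (simp add: universal_covering_map_def class_endpoint_chain_class)
qed

lemma path_lift_0: "path_lift \<U> x c 0 = x"
proof
  fix E
  show "path_lift \<U> x c 0 E = x E"
  proof (cases "E \<in> entourages \<U>")
    case False
    have "x \<in> (\<Pi>\<^sub>E E\<in>entourages \<U>. chain_space b E)" using x unfolding limit_space_def by blast
    from PiE_arb[OF this False] False show ?thesis by (simp add: path_lift_def)
  next
    case E: True
    have 0: "(0::real) \<in> {0..1}" by simp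
    obtain \<delta> \<alpha> where *: "fine_for c E \<delta>" "x E = chain_class E \<alpha>" "chain E \<alpha>" "last \<alpha> = c 0"
      using path_lift_representative[OF E 0] .
    have chain0: "chain (interval_entourage \<delta>) [0]" "hd [0::real] = 0" "last [0::real] = 0"
      by (simp_all add: chain_def)
    have lift0: "path_lift \<U> x c 0 E = chain_class E (\<alpha> @ map c [0])"
      using E * chain0 0 by (rule path_lift_eq)
    have "chain E (\<alpha> @ map c [0])" using E *(1,3,4) chain0(1,2) by (rule chain_append_path)
    moreover have "adds_point \<alpha> (\<alpha> @ map c [0])"
      unfolding adds_point_def by (intro exI[of _ \<alpha>] exI[of _ "c 0"] exI[of _ "[]"]) simp
    ultimately have "chain_step E \<alpha> (\<alpha> @ map c [0])"
      using *(3,4) unfolding chain_step_def by (simp add: chain_def)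
    then have "chain_homotopic E \<alpha> (\<alpha> @ map c [0])"
      unfolding chain_homotopic_def by (rule r_into_rtranclp)
    from chain_homotopic_sym[OF this] have "chain_class E (\<alpha> @ map c [0]) = x E"
      unfolding *(2) chain_class_eq_iff .
    with lift0 show ?thesis by simp
  qed
qed

text \<open>
  A short path changes the class at \<open>E\<close> just as the single step to its endpoint does. This is what
  makes every step of a chain realizable by a lift.
\<close>

lemma path_lift_within:
  assumes E: "E \<in> entourages \<U>" and C: "C \<times> C \<subseteq> E" "\<And>t. t \<in> {0..1} \<Longrightarrow> c t \<in> C"
    and \<alpha>: "x E = chain_class E \<alpha>" "chain E \<alpha>" "last \<alpha> = c 0"
  shows "path_lift \<U> x c 1 E = chain_class E (\<alpha> @ [c 1])"
proof -
  have 1: "(1::real) \<in> {0..1}" by simp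
  obtain \<delta> ts where *: "fine_for c E \<delta>" "chain (interval_entourage \<delta>) ts" "hd ts = 0" "last ts = 1"
    using path_lift_representative[OF E 1] .
  (* The last point of the chain for x is moved into the segment that is replaced, so that the
     segment runs from c 0 to c 1; c 0 occurs twice in it. *)
  have "path_lift \<U> x c 1 E = chain_class E (\<alpha> @ map c ts)"
    using E *(1) \<alpha> *(2-) 1 by (rule path_lift_eq)
  also have "\<dots> = chain_class E (\<alpha> @ [c 1])"
    unfolding chain_class_eq_iff
  proof -
    have ne: "\<alpha> \<noteq> []" "ts \<noteq> []" using \<alpha>(2) *(2) by (auto simp: chain_def)
    then have a: "\<alpha> = butlast \<alpha> @ [c 0]" using \<alpha>(3) by (metis append_butlast_last_id)
    have "chain E (\<alpha> @ map c ts)" using E * \<alpha> by (intro chain_append_path)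
    then have "chain E (butlast \<alpha> @ ([c 0] @ map c ts) @ [])" by (subst (asm) a) simp
    then have "chain_homotopic E (butlast \<alpha> @ ([c 0] @ map c ts) @ []) (butlast \<alpha> @ [c 0, c 1] @ [])"
    proof (rule chain_homotopic_replace[OF _ C(1)])
      have "set ts \<subseteq> {0..1}"
        using *(2,3) by (intro chain_set[of "interval_entourage \<delta>"]) (auto simp: interval_entourage_def)
      then show "set ([c 0] @ map c ts) \<subseteq> C" "set [c 0, c 1] \<subseteq> C" using C(2) by auto
      show "last ([c 0] @ map c ts) = last [c 0, c 1]" using ne *(4) by (simp add: last_map)
    qed auto
    then show "chain_homotopic E (\<alpha> @ map c ts) (\<alpha> @ [c 1])" by (subst (1 2) a) simp
  qed
  finally show ?thesis .
qed

text \<open>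
  Lifts over nearby times share a representative up to the last point: a fine chain to \<open>s\<close> can be
  continued by either \<open>s\<close> or \<open>t\<close>.
\<close>

lemma path_lift_lifted_entourage:
  assumes D: "D \<in> entourages \<U>" and E: "E \<in> entourages \<U>" and DE: "D \<subseteq> E"
    and \<delta>: "fine_for c D \<delta>" and st: "(s, t) \<in> interval_entourage \<delta>"
  shows "(path_lift \<U> x c s E, path_lift \<U> x c t E) \<in> lifted_entourage b E D"
proof -
  have t: "s \<in> {0..1}" "t \<in> {0..1}" and \<delta>0: "0 < \<delta>"
    using st \<delta> by (auto simp: interval_entourage_def fine_for_def)
  have \<delta>E: "fine_for c E \<delta>" using \<delta> DE by (rule fine_for_mono)
  obtain \<alpha> where \<alpha>: "x E = chain_class E \<alpha>" "chain E \<alpha>" "hd \<alpha> = b" "last \<alpha> = c 0"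
    using path_lift_representative[OF E t(1)] .
  obtain ts where ts: "chain (interval_entourage \<delta>) ts" "hd ts = 0" "last ts = s"
    using ex_interval_chain[OF \<delta>0 t(1)] .
  have ne: "ts \<noteq> []" "\<alpha> \<noteq> []" using ts(1) \<alpha>(2) by (auto simp: chain_def)
  have "path_lift \<U> x c r E = chain_class E ((\<alpha> @ map c ts) @ [c r]) \<and> chain E ((\<alpha> @ map c ts) @ [c r])"
    if r: "r \<in> {0..1}" "(s, r) \<in> interval_entourage \<delta>" for r
  proof -
    have tr: "chain (interval_entourage \<delta>) (ts @ [r])" "hd (ts @ [r]) = 0" "last (ts @ [r]) = r"
      using ts r ne by (simp_all add: chain_snoc)
    have "path_lift \<U> x c r E = chain_class E (\<alpha> @ map c (ts @ [r]))"
      using E \<delta>E \<alpha>(1,2,4) tr r(1) by (rule path_lift_eq)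
    moreover have "chain E (\<alpha> @ map c (ts @ [r]))"
      using E \<delta>E \<alpha>(2,4) tr(1,2) by (rule chain_append_path)
    ultimately show ?thesis by simp
  qed
  moreover have "(s, s) \<in> interval_entourage \<delta>" using t \<delta>0 by (simp add: interval_entourage_def)
  moreover have "(c s, c t) \<in> D"
    using \<delta> st by (auto simp: fine_for_def interval_entourage_def)
  ultimately show ?thesis
    using t st ne \<alpha>(3) by (auto intro!: lifted_entourageI simp del: append_assoc)
qed

lemma pathin_path_lift:
  assumes b: "b \<in> topspace X"
  shows "pathin (limit_topology \<U> b) (path_lift \<U> x c)"
proof -
  let ?L = "limit_space \<U> b" and ?f = "path_lift \<U> x c"
  note UL = uniform_structure_on_limit_space[OF uniform b]
  have sub: "\<forall>\<^sub>F s in at t within {0..1}. (?f t, ?f s) \<in> V"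
    if V: "V \<in> limit_subbase \<U> b" and t: "t \<in> {0..1}" for V t
  proof -
    obtain E W where E: "E \<in> entourages \<U>" "W \<in> chain_uniformity \<U> b E"
      and V_eq: "V = {(x, y) \<in> ?L \<times> ?L. (x E, y E) \<in> W}"
      using V by (auto simp: limit_subbase_def)
    then obtain D where D: "D \<in> entourages \<U>" "D \<subseteq> E" "lifted_entourage b E D \<subseteq> W"
      by (auto simp: chain_uniformity_def uniformity_from_base_def)
    then have "D \<in> \<U>" by (simp add: entourages_def)
    then obtain \<delta> where \<delta>: "fine_for c D \<delta>" using ex_fine_for[OF X c(1)] by metis
    have "(?f t, ?f s) \<in> V" if "s \<in> {0..1}" "dist s t < \<delta>" for s
    proof -
      have "(t, s) \<in> interval_entourage \<delta>"
        using t that by (auto simp: interval_entourage_def dist_real_def)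
      then have "(?f t E, ?f s E) \<in> W"
        using path_lift_lifted_entourage[OF D(1) E(1) D(2) \<delta>] D(3) by blast
      then show ?thesis using t that path_lift_in_limit_space unfolding V_eq by auto
    qed
    then show ?thesis
      using \<delta> unfolding eventually_at fine_for_def by blast
  qed
  have "openin (top_of_set {0..1}) {t \<in> {0..1}. ?f t \<in> G}"
    if G: "openin (limit_topology \<U> b) G" for G
    unfolding openin_euclidean_subtopology_iff
  proof (intro conjI ballI)
    fix t assume "t \<in> {t \<in> {0..1}. ?f t \<in> G}"
    then have t: "t \<in> {0..1}" "?f t \<in> G" by auto
    then obtain V where V: "V \<in> limit_uniformity \<U> b" "V `` {?f t} \<subseteq> G"
      using G openin_uniform_topology[OF UL] by (auto simp: limit_topology_def)
    then obtain \<F> where F: "finite \<F>" "\<F> \<subseteq> limit_subbase \<U> b" "?L \<times> ?L \<inter> \<Inter>\<F> \<subseteq> V"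
      by (auto simp: limit_uniformity_def uniformity_from_base_def)
    have "\<forall>\<^sub>F s in at t within {0..1}. \<forall>V\<in>\<F>. (?f t, ?f s) \<in> V"
      using F(1,2) sub t(1) by (intro eventually_ball_finite) auto
    then obtain d where d: "d > 0"
        "\<And>s. s \<in> {0..1} \<Longrightarrow> s \<noteq> t \<Longrightarrow> dist s t < d \<Longrightarrow> \<forall>V\<in>\<F>. (?f t, ?f s) \<in> V"
      unfolding eventually_at by blast
    have "?f s \<in> G" if s: "s \<in> {0..1}" "dist s t < d" for s
    proof (cases "s = t")
      case False
      then have "(?f t, ?f s) \<in> ?L \<times> ?L \<inter> \<Inter>\<F>"
        using d(2) s t(1) path_lift_in_limit_space by auto
      with F(3) V(2) show ?thesis by blast
    qed (use t in simp)
    with d(1) show "\<exists>e>0. \<forall>s\<in>{0..1}. dist s t < e \<longrightarrow> s \<in> {t \<in> {0..1}. ?f t \<in> G}" by auto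
  qed auto
  moreover have "topspace (limit_topology \<U> b) = ?L"
    unfolding limit_topology_def by (rule topspace_uniform_topology[OF UL])
  ultimately show ?thesis
    using path_lift_in_limit_space by (simp add: pathin_def continuous_map_def)
qed

end


section \<open>Peano continua\<close>

text \<open>
  The interval inherits local path connectedness from the line as a retract, by truncation.
\<close>

lemma locally_path_connected_unit_interval: "locally_path_connected_space (top_of_set {0..1::real})"
proof (rule locally_path_connected_space_retraction_map_image)
  show "retraction_map euclideanreal (top_of_set {0..1}) (\<lambda>t. max 0 (min 1 t))"
    unfolding retraction_map_def retraction_maps_def
    by (intro exI[of _ id] conjI)
      (auto simp: continuous_map_in_subtopology intro!: continuous_intros)
qed (rule locally_path_connected_space_euclideanreal)

lemma Peano_continuum_compact: "Peano_continuum X \<Longrightarrow> compact_space X"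
  unfolding Peano_continuum_def pathin_def compact_space_def
  using image_compactin[of "top_of_set {0..1::real}" "{0..1}" X] by (force simp: compactin_subtopology)

lemma Peano_continuum_locally_path_connected:
  assumes "Peano_continuum X"
  shows "locally_path_connected_space X"
proof -
  obtain g where g: "continuous_map (top_of_set {0..1::real}) X g" "g ` {0..1} = topspace X"
    and X: "Hausdorff_space X"
    using assms by (auto simp: Peano_continuum_def pathin_def)
  have "quotient_map (top_of_set {0..1::real}) X g"
    using g X by (intro continuous_imp_quotient_map) (auto simp: compact_space_subtopology)
  then show ?thesis
    using locally_path_connected_unit_interval by (rule locally_path_connected_space_quotient_map_image)
qed

lemma Peano_continuum_path_connected:
  assumes "Peano_continuum X"
  shows "path_connectedin X (topspace X)"
proof -
  obtain g where g: "continuous_map (top_of_set {0..1::real}) X g" "g ` {0..1} = topspace X"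
    using assms by (auto simp: Peano_continuum_def pathin_def)
  have "path_connectedin (top_of_set {0..1::real}) {0..1}"
    by (simp add: path_connectedin_subtopology)
  from path_connectedin_continuous_map_image[OF g(1) this] show ?thesis
    by (simp add: g(2))
qed

text \<open>
  A parametrization \<open>g\<close> with \<open>g r = b\<close> is run from \<open>r\<close> down to \<open>0\<close> and then up to \<open>1\<close>; the
  reparametrization \<open>\<bar>r - (1 + r) * s\<bar>\<close> does this in one formula.
\<close>

lemma Peano_continuum_surjective_path_from:
  assumes "Peano_continuum X" "b \<in> topspace X"
  obtains c where "pathin X c" "c 0 = b" "c ` {0..1} = topspace X"
proof -
  obtain g where g: "pathin X g" "g ` {0..1} = topspace X"
    using assms(1) by (auto simp: Peano_continuum_def)
  then obtain r where r: "r \<in> {0..1}" "g r = b" using assms(2) by force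
  define h where "h = (\<lambda>s::real. \<bar>r - (1 + r) * s\<bar>)"
  have h_in: "h s \<in> {0..1}" if s: "s \<in> {0..1}" for s
  proof -
    have "0 \<le> (1 + r) * s" "(1 + r) * s \<le> (1 + r) * 1"
      using s r(1) by (simp, intro mult_left_mono) auto
    moreover have "0 \<le> r" "r \<le> 1" using r(1) by auto
    ultimately have "\<bar>r - (1 + r) * s\<bar> \<le> 1" unfolding mult_1_right by linarith
    then show ?thesis by (simp add: h_def)
  qed
  have h_onto: "t \<in> h ` {0..1}" if t: "t \<in> {0..1}" for t
  proof
    have "0 < 1 + r" using r(1) by simp
    then show "t = h ((r + t) / (1 + r))" "(r + t) / (1 + r) \<in> {0..1}"
      using t r(1) by (auto simp: h_def)
  qed
  have "continuous_map (top_of_set {0..1}) (top_of_set {0..1}) h"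
    using h_in by (auto simp: continuous_map_in_subtopology h_def intro!: continuous_intros)
  then have "pathin X (g \<circ> h)"
    using g(1) unfolding pathin_def by (rule continuous_map_compose)
  moreover have "(g \<circ> h) 0 = b" using r by (simp add: h_def)
  moreover have "h ` {0..1} = {0..1}" using h_in h_onto by blast
  then have "(g \<circ> h) ` {0..1} = topspace X" using g(2) by (simp flip: image_image add: image_comp[symmetric])
  ultimately show thesis by (rule that)
qed

text \<open>
  The pairs in \<open>F\<close> joined by a path that is itself small of order \<open>F\<close>, and so, since the squares
  are contained in the union, small of the order of the new relation as well.
\<close>

definition path_connected_core :: "'a topology \<Rightarrow> ('a \<times> 'a) set \<Rightarrow> ('a \<times> 'a) set" where
  "path_connected_core X F = \<Union>{C \<times> C | C. path_connectedin X C \<and> C \<times> C \<subseteq> F}"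

lemma path_connected_core_subset: "path_connected_core X F \<subseteq> F"
  by (auto simp: path_connected_core_def)

text \<open>
  Path connected open sets that are small of order \<open>F\<close> cover \<open>X\<close>, so some entourage is subordinate to
  this cover, and it is contained in the core.
\<close>

lemma path_connected_core_entourage:
  assumes X: "compatible_uniformity X \<U>" "compact_space X" "locally_path_connected_space X"
    and F: "F \<in> \<U>"
  shows "path_connected_core X F \<in> entourages \<U>"
proof -
  let ?S = "topspace X" and ?E = "path_connected_core X F"
  have U: "uniform_structure_on ?S \<U>" and top: "uniform_topology ?S \<U> = X"
    using X(1) by (simp_all add: compatible_uniformity_def)
  define \<C> where "\<C> = {C. openin X C \<and> path_connectedin X C \<and> C \<times> C \<subseteq> F}"
  obtain D where D: "D \<in> entourages \<U>" "D O D \<subseteq> F"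
    using uniform_structure_entourage_half[OF U F] .
  have "\<exists>C\<in>\<C>. x \<in> C" if x: "x \<in> ?S" for x
  proof -
    obtain G where G: "openin X G" "x \<in> G" "G \<subseteq> D `` {x}"
      using uniform_neighbourhood[OF U _ x, of D] D(1) top by (auto simp: entourages_def)
    then obtain C where C: "openin X C" "path_connectedin X C" "x \<in> C" "C \<subseteq> G"
      using X(3) unfolding locally_path_connected_space by blast
    have "sym D" using D(1) by (simp add: entourages_def)
    then have "C \<times> C \<subseteq> F" using C(4) G(3) D(2) by (blast dest: symD)
    with C show ?thesis by (auto simp: \<C>_def)
  qed
  then have "?S \<subseteq> \<Union>\<C>" by blast
  moreover have "openin X C" if "C \<in> \<C>" for C using that by (simp add: \<C>_def)
  ultimately obtain D' where D': "D' \<in> \<U>" "\<And>x. x \<in> ?S \<Longrightarrow> \<exists>C\<in>\<C>. D' `` {x} \<subseteq> C"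
    using uniform_Lebesgue[OF X(1,2), of \<C>] by metis
  have "D' \<subseteq> ?E"
  proof clarify
    fix x y assume xy: "(x, y) \<in> D'"
    then have x: "x \<in> ?S" using uniform_structure_subset[OF U D'(1)] by auto
    then obtain C where C: "C \<in> \<C>" "D' `` {x} \<subseteq> C" using D'(2) by blast
    have "(x, x) \<in> D'" using uniform_structure_diag[OF U D'(1)] x by auto
    then have "(x, y) \<in> C \<times> C" using C(2) xy by auto
    with C(1) show "(x, y) \<in> ?E" by (auto simp: \<C>_def path_connected_core_def)
  qed
  moreover have "?E \<subseteq> ?S \<times> ?S"
    using path_connected_core_subset uniform_structure_subset[OF U F] by (rule order_trans)
  ultimately have "?E \<in> \<U>"
    using U D'(1) unfolding uniform_structure_on_def by blast
  moreover have "sym ?E" by (auto simp: sym_def path_connected_core_def)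
  ultimately show ?thesis by (simp add: entourages_def)
qed

text \<open>
  Induction along a chain: a point of the limit representing the initial segment is moved along a
  path joining the ends of the last step.
\<close>

lemma limit_projection_surj:
  assumes X: "compatible_uniformity X \<U>"
    and E: "path_connected_core X F \<in> entourages \<U>" and b: "b \<in> topspace X"
  shows "(\<lambda>x. x (path_connected_core X F)) ` limit_space \<U> b = chain_space b (path_connected_core X F)"
proof -
  let ?E = "path_connected_core X F"
  have U: "uniform_structure_on (topspace X) \<U>" using X by (simp add: compatible_uniformity_def)
  have lift: "\<exists>x\<in>limit_space \<U> b. x ?E = chain_class ?E \<alpha>" if "\<alpha> \<noteq> []" "chain ?E \<alpha>" "hd \<alpha> = b" for \<alpha>
    using that
  proof (induction \<alpha> rule: rev_nonempty_induct)
    case (single y)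
    then have "limit_basepoint \<U> b ?E = chain_class ?E [y]"
      using E by (simp add: limit_basepoint_def)
    then show ?case using limit_basepoint_in_limit_space by (rule bexI)
  next
    case (snoc y \<alpha>)
    then have \<alpha>: "chain ?E \<alpha>" "(last \<alpha>, y) \<in> ?E" "hd \<alpha> = b" by (simp_all add: chain_snoc)
    then obtain x where x: "x \<in> limit_space \<U> b" "x ?E = chain_class ?E \<alpha>" using snoc.IH by blast
    obtain C where C: "path_connectedin X C" "C \<times> C \<subseteq> F" "last \<alpha> \<in> C" "y \<in> C"
      using \<alpha>(2) unfolding path_connected_core_def by blast
    then obtain c where c: "pathin X c" "c \<in> {0..1} \<rightarrow> C" "c 0 = last \<alpha>" "c 1 = y"
      unfolding path_connectedin by blast
    have CE: "C \<times> C \<subseteq> ?E" using C(1,2) unfolding path_connected_core_def by blast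
    obtain \<beta> where "x ?E = chain_class ?E \<beta>" "last \<beta> = universal_covering_map (topspace X) x"
      using limit_space_representative[OF U x(1) E] .
    then have end_x: "c 0 = universal_covering_map (topspace X) x"
      using x(2) c(3) class_endpoint_chain_class[of ?E \<alpha>] class_endpoint_chain_class[of ?E \<beta>] by simp
    have "c t \<in> C" if "t \<in> {0..1}" for t using c(2) that by blast
    then have "path_lift \<U> x c 1 ?E = chain_class ?E (\<alpha> @ [c 1])"
      using x(2) \<alpha>(1) c(3)[symmetric] by (rule path_lift_within[OF X x(1) c(1) end_x E CE])
    moreover have "path_lift \<U> x c 1 \<in> limit_space \<U> b"
      by (rule path_lift_in_limit_space[OF X x(1) c(1) end_x]) simp
    ultimately show ?case unfolding c(4) by (rule bexI)
  qed
  show ?thesis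
  proof (intro equalityI subsetI)
    fix k assume "k \<in> (\<lambda>x. x ?E) ` limit_space \<U> b"
    then show "k \<in> chain_space b ?E" using E unfolding limit_space_def by blast
  next
    fix k assume "k \<in> chain_space b ?E"
    then obtain \<alpha> where "k = chain_class ?E \<alpha>" "chain ?E \<alpha>" "hd \<alpha> = b"
      by (auto simp: chain_space_def)
    moreover from this have "\<alpha> \<noteq> []" by (simp add: chain_def)
    ultimately obtain x where "x \<in> limit_space \<U> b" "x ?E = k" using lift[of \<alpha>] by blast
    then show "k \<in> (\<lambda>x. x ?E) ` limit_space \<U> b" by blast
  qed
qed

text \<open>
  The cores form the required base. The full relation is its own core because \<open>X\<close> is path connected.
\<close>

lemma Peano_continuum_coverable:
  assumes P: "Peano_continuum X" and X: "compatible_uniformity X \<U>" and b: "b \<in> topspace X"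
  shows "coverable (topspace X) \<U> b"
proof -
  let ?S = "topspace X"
  have U: "uniform_structure_on ?S \<U>" using X by (simp add: compatible_uniformity_def)
  note core = path_connected_core_entourage[OF X Peano_continuum_compact[OF P]
      Peano_continuum_locally_path_connected[OF P]]
  have "path_connected_core X (?S \<times> ?S) = ?S \<times> ?S"
    using Peano_continuum_path_connected[OF P] path_connected_core_subset[of X "?S \<times> ?S"]
    by (auto simp: path_connected_core_def)
  then have "?S \<times> ?S \<in> path_connected_core X ` \<U>"
    using uniform_structure_full[OF U] by (metis imageI)
  moreover have "\<forall>E\<in>\<U>. \<exists>D\<in>path_connected_core X ` \<U>. D \<subseteq> E"
    using path_connected_core_subset by blast
  moreover have "path_connected_core X ` \<U> \<subseteq> entourages \<U>" using core by blast
  moreover have "\<forall>E\<in>path_connected_core X ` \<U>. (\<lambda>x. x E) ` limit_space \<U> b = chain_space b E"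
    using limit_projection_surj[OF X core b] by blast
  ultimately show ?thesis unfolding coverable_def by blast
qed

theorem corollary97:
  fixes X :: "'a topology" and \<U> :: "('a \<times> 'a) set set" and b :: 'a
  assumes "Peano_continuum X"
    and "compatible_uniformity X \<U>"
    and "b \<in> topspace X"
  shows "coverable (topspace X) \<U> b \<and>
    (\<exists>S. compactin (limit_topology \<U> b) S \<and>
         S \<subseteq> path_component_of_set (limit_topology \<U> b) (limit_basepoint \<U> b) \<and>
         universal_covering_map (topspace X) ` S = topspace X)"
proof
  let ?L = "limit_topology \<U> b" and ?o = "limit_basepoint \<U> b"
  show "coverable (topspace X) \<U> b" using assms by (rule Peano_continuum_coverable)
  obtain c where c: "pathin X c" "c 0 = b" "c ` {0..1} = topspace X"
    using Peano_continuum_surjective_path_from[OF assms(1,3)] .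
  have "topspace X \<times> topspace X \<in> entourages \<U>"
    using assms(2) full_entourage by (auto simp: compatible_uniformity_def)
  then have end_o: "c 0 = universal_covering_map (topspace X) ?o"
    using c(2) by (simp add: universal_covering_map_def limit_basepoint_def class_endpoint_chain_class)
  note o = assms(2) limit_basepoint_in_limit_space c(1) end_o
  let ?f = "path_lift \<U> ?o c"
  have f: "continuous_map (top_of_set {0..1}) ?L ?f"
    using pathin_path_lift[OF o assms(3)] by (simp add: pathin_def)
  have "compactin (top_of_set {0..1::real}) {0..1}" by (simp add: compactin_subtopology)
  then have "compactin ?L (?f ` {0..1})" using f by (rule image_compactin)
  moreover have "path_connectedin (top_of_set {0..1::real}) {0..1}"
    by (simp add: path_connectedin_subtopology)
  then have "path_connectedin ?L (?f ` {0..1})"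
    by (rule path_connectedin_continuous_map_image[OF f])
  then have "?f ` {0..1} \<subseteq> path_component_of_set ?L ?o"
    using path_lift_0[OF o] by (intro path_component_of_maximal) (auto intro!: image_eqI[of _ _ 0])
  moreover have "universal_covering_map (topspace X) ` ?f ` {0..1} = topspace X"
    using universal_covering_map_path_lift[OF o] c(3) by (simp add: image_image)
  ultimately show "\<exists>S. compactin ?L S \<and> S \<subseteq> path_component_of_set ?L ?o \<and>
      universal_covering_map (topspace X) ` S = topspace X" by blast
qed

end
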